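(* Let $n=1$ and $\alpha>1$. There exists a potential $V\in C^2(\mathbb{T})$ with $V\ge 0$, having exactly two zeroes, both nondegenerate (that is, $V''>0$ at each of the two zeroes), such that the following holds. For $\varepsilon>0$ let $w^\varepsilon$ be the solution of $$\varepsilon^\alpha w^\varepsilon-\varepsilon (w^\varepsilon)''+|(w^\varepsilon)'|^2=V\qquad\text{in }\mathbb{T}.$$ Then the normalized solutions $$z^\varepsilon:=w^\varepsilon+\frac{c(\varepsilon)}{\varepsilon^\alpha}$$ do not converge in $C(\mathbb{T})$ as $\varepsilon\to 0$.
   Context: $\mathbb{T}=\mathbb{R}/\mathbb{Z}$. The equation for $w^\varepsilon$ has, for each $\varepsilon>0$, a unique viscosity solution, which is classical. For $\varepsilon>0$, $c(\varepsilon)\in\mathbb{R}$ denotes the unique constant for which the viscous ergodic problem $-\varepsilon(\chi^\varepsilon)''+|(\chi^\varepsilon)'|^2=V+c(\varepsilon)$ in $\mathbb{T}$ admits a (periodic) solution $\chi^\varepsilon$. Convergence in $C(\mathbb{T})$ is uniform convergence. *)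

theory Defs
  imports "HOL-Analysis.Analysis"
begin

text \<open>Functions on the torus \<open>\<real>/\<int>\<close> are represented by their 1-periodic lifts to \<open>\<real>\<close>.\<close>

definition periodic1 :: "(real \<Rightarrow> real) \<Rightarrow> bool" where
  "periodic1 f \<longleftrightarrow> (\<forall>x. f (x + 1) = f x)"

definition C_torus :: "(real \<Rightarrow> real) set" where
  "C_torus = {f. periodic1 f \<and> continuous_on UNIV f}"

text \<open>The differentiability conjuncts are needed because \<^const>\<open>deriv\<close> is total, with an
  unspecified value where no derivative exists.\<close>

definition C2_torus :: "(real \<Rightarrow> real) set" where
  "C2_torus = {f. periodic1 f \<and>
     (\<forall>x. f field_differentiable at x) \<and>
     (\<forall>x. deriv f field_differentiable at x) \<and>
     continuous_on UNIV (deriv (deriv f))}"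

text \<open>Both equations are understood in the classical sense: for \<open>\<epsilon> > 0\<close> the discounted
  equation has a unique viscosity solution, and that solution is classical.\<close>

definition discounted_solution ::
  "real \<Rightarrow> real \<Rightarrow> (real \<Rightarrow> real) \<Rightarrow> (real \<Rightarrow> real) \<Rightarrow> bool" where
  "discounted_solution \<alpha> \<epsilon> V w \<longleftrightarrow> w \<in> C2_torus \<and>
     (\<forall>x. \<epsilon> powr \<alpha> * w x - \<epsilon> * deriv (deriv w) x + \<bar>deriv w x\<bar>^2 = V x)"

definition ergodic_solution ::
  "real \<Rightarrow> (real \<Rightarrow> real) \<Rightarrow> real \<Rightarrow> (real \<Rightarrow> real) \<Rightarrow> bool" where
  "ergodic_solution \<epsilon> V c u \<longleftrightarrow> u \<in> C2_torus \<and>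
     (\<forall>x. - \<epsilon> * deriv (deriv u) x + \<bar>deriv u x\<bar>^2 = V x + c)"

text \<open>For \<open>\<epsilon> > 0\<close> and continuous periodic \<open>V\<close> exactly one \<open>c\<close> satisfies this predicate.\<close>

definition ergodic_constant :: "real \<Rightarrow> (real \<Rightarrow> real) \<Rightarrow> real \<Rightarrow> bool" where
  "ergodic_constant \<epsilon> V c \<longleftrightarrow> (\<exists>u. ergodic_solution \<epsilon> V c u)"

text \<open>Convergence in \<open>C(\<real>/\<int>)\<close> of a family indexed by \<open>\<epsilon> > 0\<close>, as \<open>\<epsilon> \<rightarrow> 0\<close>; uniformity
  over a period and over \<open>\<real>\<close> coincide for periodic functions.\<close>

definition converges_in_C_torus :: "(real \<Rightarrow> real \<Rightarrow> real) \<Rightarrow> bool" where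
  "converges_in_C_torus z \<longleftrightarrow>
     (\<exists>z0 \<in> C_torus. uniform_limit UNIV z z0 (at_right 0))"

end

theory Submission
  imports Defs
begin

text \<open>Adding a constant to \<open>w^\<epsilon>\<close> does not change differences of its values, so it is enough to find a potential with wells at
  \<open>0\<close> and \<open>1/2\<close> for which \<open>w^\<epsilon> 0 - w^\<epsilon> (1/2)\<close> exceeds a positive constant along one
  sequence \<open>\<epsilon> \<rightarrow> 0\<close> and lies below a negative constant along another.

  Staying near a well costs, per unit time, the ground state energy of that well, which is \<open>\<epsilon>\<close> times a stiffness
  determined by the shape of the potential at distance about \<open>sqrt \<epsilon>\<close>. If the two energies differ by much more than
  \<open>\<epsilon> powr \<alpha>\<close>, the discounted problem prefers the softer well, and reaching it from the stiffer well costs a fixed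
  positive amount. Both wells have the same second derivative, so their energies agree to leading order; but since
  \<open>\<alpha> > 1\<close> there is room for a gap \<open>\<epsilon> * \<eta>\<close> with \<open>\<epsilon> powr \<alpha> \<lless> \<epsilon> * \<eta> \<lless> \<epsilon>\<close>. The potential is \<open>sin (2*pi*x)^2\<close>
  plus a \<open>C^2\<close>-convergent sum of bumps, the \<open>k\<close>-th of relative weight \<open>\<eta> = 16^-k\<close>, which alternately stiffen one of
  the wells at all distances above about \<open>sqrt (e k)\<close> and are invisible far below. For a rapidly decreasing sequence
  \<open>e\<close> the well that is stiffer at \<open>\<epsilon> = e k\<close> is the one chosen by the parity of \<open>k\<close>.

  The proof needs two estimates at \<open>\<epsilon> = e k\<close>. Comparison with an explicit supersolution centred at the soft well
  bounds \<open>\<epsilon> powr \<alpha> * w\<close> everywhere by the soft energy (\<open>discounted_solution_upper_bound\<close>). Since this lies below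
  the energy of the stiff well, a Wronskian comparison shows that \<open>w\<close> cannot increase on both sides of it: on
  one side it starts to decrease almost at once and goes on decreasing
  until the soft well is near (\<open>descent_across_stiff_well\<close>). A uniform limit would therefore
  be larger at \<open>0\<close> than at \<open>1/2\<close>, from the even scales, and larger at \<open>1/2\<close> than at \<open>0\<close>, from the odd ones.\<close>

section \<open>Maximum and barrier principles on the line\<close>

lemma derivatives_at_global_max:
  fixes f f' :: "real \<Rightarrow> real"
  assumes f: "\<And>x. (f has_real_derivative f' x) (at x)"
    and f': "(f' has_real_derivative d) (at a)"
    and max: "\<And>x. f x \<le> f a"
  shows "f' a = 0" and "d \<le> 0"
proof -
  show zero: "f' a = 0"
    using DERIV_local_max[OF f zero_less_one] max by blast
  show "d \<le> 0"
  proof (rule ccontr)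
    assume "\<not> d \<le> 0"
    then obtain h where "h > 0" and h: "\<And>t. 0 < t \<Longrightarrow> t < h \<Longrightarrow> f' a < f' (a + t)"
      using DERIV_pos_inc_right[OF f'] by (metis not_le)
    have "a < a + h/2" using \<open>h > 0\<close> by simp
    then obtain z where z: "a < z" "z < a + h/2" "f (a + h/2) - f a = (a + h/2 - a) * f' z"
      using MVT2[of a "a + h/2" f f'] f by blast
    have "f' z > 0" using h[of "z - a"] z zero \<open>h > 0\<close> by simp
    then have "(a + h/2 - a) * f' z > 0" using \<open>h > 0\<close> by simp
    then have "f (a + h/2) - f a > 0" using z by linarith
    with max[of "a + h/2"] show False by simp
  qed
qed

text \<open>At the last time before \<open>t\<close> at which \<open>v\<close> is at most \<open>m\<close>, the value is \<open>m\<close> and \<open>v\<close>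
  exceeds \<open>m\<close> right afterwards, against the sign of its derivative there.\<close>

lemma barrier_from_above:
  fixes v v' :: "real \<Rightarrow> real"
  assumes v: "\<And>t. (v has_real_derivative v' t) (at t)"
    and start: "v a \<le> m"
    and barrier: "\<And>t. a \<le> t \<Longrightarrow> t \<le> b \<Longrightarrow> v t = m \<Longrightarrow> v' t < 0"
    and t: "a \<le> t" "t \<le> b"
  shows "v t \<le> m"
proof (rule ccontr)
  assume above: "\<not> v t \<le> m"
  define A where "A = {s \<in> {a..t}. v s \<le> m}"
  have cont: "continuous_on X v" for X
    by (meson DERIV_continuous_on has_field_derivative_at_within v)
  have "closed A"
    unfolding A_def by (rule continuous_on_closed_Collect_le[OF cont continuous_on_const closed_atLeastAtMost])
  moreover have "bounded A" unfolding A_def by (rule bounded_subset[of "{a..t}"]) auto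
  ultimately have "compact A" by (simp add: compact_eq_bounded_closed)
  moreover have "a \<in> A" using start t by (simp add: A_def)
  ultimately obtain s where s: "s \<in> A" "\<And>x. x \<in> A \<Longrightarrow> x \<le> s"
    by (metis compact_attains_sup empty_iff)
  have st: "a \<le> s" "s < t" "v s \<le> m"
    using s(1) above by (auto simp: A_def less_le)
  have beyond: "v x > m" if "s < x" "x \<le> t" for x
    using s(2)[of x] that st by (force simp: A_def)
  have "v s = m"
  proof (rule ccontr)
    assume "v s \<noteq> m"
    then obtain x where "s \<le> x" "x \<le> t" "v x = m"
      using IVT'[of v s m t] st above cont by force
    with beyond[of x] \<open>v s \<noteq> m\<close> show False by (cases "x = s") auto
  qed
  then obtain h where h: "h > 0" "\<And>k. 0 < k \<Longrightarrow> k < h \<Longrightarrow> v (s + k) < m"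
    using DERIV_neg_dec_right[OF v barrier[of s]] st t by auto
  define k where "k = min (h/2) (t - s)"
  have "0 < k" "k < h" "s + k \<le> t" using h(1) st by (auto simp: k_def min_def)
  with h(2)[of k] beyond[of "s + k"] show False by simp
qed

section \<open>A soft well keeps the solution low everywhere\<close>

text \<open>Comparison with the supersolution whose derivative is \<open>\<kappa> \<theta> + Q \<theta>^3\<close>, where \<open>\<theta> = 2*pi*t\<close>. The linear
  part produces the ground state energy \<open>2*pi*\<epsilon>*\<kappa>\<close> of a quadratic well; the cubic part dominates
  a quartic error in the potential, at the price \<open>6*pi*\<epsilon>*Q\<close> in the quadratic coefficient. The comparison
  takes place on the whole line instead of the circle: there the supersolution \<open>U\<close> is smooth and tends
  to infinity, so that \<open>w - U\<close> attains its maximum, and nothing has to be known about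
  the potential outside the well beyond the quartic bound.\<close>

lemma discounted_solution_upper_bound:
  fixes w v v' F :: "real \<Rightarrow> real"
  assumes w: "\<And>t. (w has_real_derivative v t) (at t)"
    and v: "\<And>t. (v has_real_derivative v' t) (at t)"
    and per: "\<And>t. w (t + 1) = w t"
    and eq: "\<And>t. \<mu> * w t - \<epsilon> * v' t + (v t)\<^sup>2 = F t"
    and F: "\<And>t. F t \<le> a * (2*pi*t)\<^sup>2 + Q * (2*pi*t)^4"
    and pos: "\<epsilon> > 0" "\<mu> > 0" "Q \<ge> 0" "\<kappa> \<ge> 1" and \<kappa>: "a + 6*pi*\<epsilon>*Q \<le> \<kappa>\<^sup>2"
  shows "\<mu> * w x \<le> 2*pi*\<epsilon>*\<kappa> + \<mu> * (\<kappa> + 4*Q)"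
proof -
  define U where "U t = pi * \<kappa> * t\<^sup>2 + 2 * pi^3 * Q * t^4" for t :: real
  define U1 where "U1 t = \<kappa> * (2*pi*t) + Q * (2*pi*t)^3" for t :: real
  define U2 where "U2 t = 2*pi*\<kappa> + 6*pi*Q * (2*pi*t)\<^sup>2" for t :: real
  have U: "(U has_real_derivative U1 t) (at t)" for t
    unfolding U_def U1_def
    by (auto intro!: derivative_eq_intros simp: algebra_simps power2_eq_square power3_eq_cube)
  have U1: "(U1 has_real_derivative U2 t) (at t)" for t
    unfolding U2_def U1_def
    by (auto intro!: derivative_eq_intros simp: algebra_simps power2_eq_square power3_eq_cube)
  have super: "a * \<theta>\<^sup>2 + Q * \<theta>^4 \<le> (\<kappa> * \<theta> + Q * \<theta>^3)\<^sup>2 - \<epsilon> * (6*pi*Q * \<theta>\<^sup>2)" for \<theta> :: real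
  proof -
    have "a * \<theta>\<^sup>2 + \<epsilon> * (6*pi*Q * \<theta>\<^sup>2) = (a + 6*pi*\<epsilon>*Q) * \<theta>\<^sup>2" by (simp add: algebra_simps)
    also have "\<dots> \<le> \<kappa>\<^sup>2 * \<theta>\<^sup>2" using \<kappa> by (intro mult_right_mono) auto
    finally have 1: "a * \<theta>\<^sup>2 + \<epsilon> * (6*pi*Q * \<theta>\<^sup>2) \<le> \<kappa>\<^sup>2 * \<theta>\<^sup>2" .
    have "1 * (Q * \<theta>^4) \<le> (2 * \<kappa>) * (Q * \<theta>^4)" using pos by (intro mult_right_mono) auto
    moreover have "(\<kappa> * \<theta> + Q * \<theta>^3)\<^sup>2 = \<kappa>\<^sup>2 * \<theta>\<^sup>2 + 2 * \<kappa> * (Q * \<theta>^4) + (Q * \<theta>^3)\<^sup>2"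
      by (simp add: power2_eq_square eval_nat_numeral algebra_simps)
    ultimately show ?thesis using 1 zero_le_power2[of "Q * \<theta>^3"] by linarith
  qed
  have cont: "continuous_on X w" "continuous_on X U" for X
    by (meson DERIV_continuous_on has_field_derivative_at_within w U)+
  obtain M where M: "\<And>t. t \<in> {0..1} \<Longrightarrow> \<bar>w t\<bar> \<le> M"
    using compact_imp_bounded[OF compact_continuous_image[OF cont(1) compact_Icc[of 0 1]]]
    unfolding bounded_iff by (metis imageI real_norm_def)
  have shift: "w (t + of_int n) = w t" for t n
  proof (induction n rule: int_induct[where k = 0])
    case (step1 i) then show ?case using per[of "t + of_int i"] by (simp add: algebra_simps)
  next
    case (step2 i) then show ?case using per[of "t + of_int (i - 1)"] by (simp add: algebra_simps)
  qed simp
  have bound: "\<bar>w t\<bar> \<le> M" for t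
    using M[of "frac t"] shift[of t "- \<lfloor>t\<rfloor>"] frac_lt_1[of t] by (simp add: frac_def)
  \<comment> \<open>Outside \<open>[-R, R]\<close> the quadratic growth of \<open>U\<close> exceeds the oscillation \<open>2 * M\<close> of \<open>w\<close>.\<close>
  define R where "R = 1 + 2 * M"
  have M0: "M \<ge> 0" using bound[of 0] by linarith
  have "\<exists>b\<in>{-R..R}. \<forall>y\<in>{-R..R}. w y - U y \<le> w b - U b"
    using M0 by (intro continuous_attains_sup continuous_intros cont) (auto simp: R_def)
  then obtain b where b: "\<And>y. \<bar>y\<bar> \<le> R \<Longrightarrow> w y - U y \<le> w b - U b"
    by (metis abs_le_iff atLeastAtMost_iff minus_le_iff)
  have U_ge: "U t \<ge> t\<^sup>2" for t
  proof -
    have "1 * 1 * t\<^sup>2 \<le> pi * \<kappa> * t\<^sup>2"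
      using pos pi_gt3 by (intro mult_right_mono mult_mono) auto
    moreover have "0 \<le> 2 * pi^3 * Q * t^4" using pos by simp
    ultimately show ?thesis unfolding U_def by linarith
  qed
  have max: "w y - U y \<le> w b - U b" for y
  proof (cases "\<bar>y\<bar> \<le> R")
    case False
    then have "R\<^sup>2 \<le> y\<^sup>2" using M0 by (metis R_def abs_le_square_iff abs_of_nonneg add_nonneg_nonneg
          linorder_linear mult_nonneg_nonneg zero_le_numeral zero_le_one)
    moreover have "2 * M \<le> R\<^sup>2" using M0 by (simp add: R_def power2_eq_square algebra_simps)
    ultimately have "U y \<ge> 2 * M" using U_ge[of y] by linarith
    then have "w y - U y \<le> w 0 - U 0" using bound[of y] bound[of 0] by (simp add: U_def)
    also have "\<dots> \<le> w b - U b" using b[of 0] M0 by (simp add: R_def)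
    finally show ?thesis .
  qed (rule b)
  have "v b - U1 b = 0" "v' b - U2 b \<le> 0"
    using derivatives_at_global_max[of "\<lambda>t. w t - U t" "\<lambda>t. v t - U1 t" "v' b - U2 b" b] max
    by (auto intro!: derivative_intros w v U U1)
  then have vb: "v b = U1 b" "\<epsilon> * v' b \<le> \<epsilon> * U2 b" using pos by auto
  have wb: "\<mu> * w b \<le> 2*pi*\<epsilon>*\<kappa>"
    using eq[of b] F[of b] super[of "2*pi*b"] vb unfolding U1_def U2_def by (simp add: algebra_simps)
  \<comment> \<open>By periodicity the bound is only needed on one period, where \<open>U\<close> is controlled.\<close>
  define y where "y = x - of_int \<lfloor>x + 1/2\<rfloor>"
  have wy: "w y = w x" using shift[of x "- \<lfloor>x + 1/2\<rfloor>"] by (simp add: y_def)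
  have y: "\<bar>y\<bar> \<le> 1/2" unfolding y_def by linarith
  have y2: "y\<^sup>2 \<le> 1/4" using power_mono[OF y, of 2] by (simp add: power2_eq_square)
  have y4: "y^4 \<le> 1/16" using power_mono[OF y, of 4] by (simp add: eval_nat_numeral)
  have "pi * \<kappa> * y\<^sup>2 \<le> 4 * \<kappa> * (1/4)"
    using y2 pi_less_4 pos by (intro mult_mono) auto
  moreover have "2 * pi^3 * Q * y^4 \<le> 64 * Q * (1/16)"
  proof -
    have "pi^3 \<le> (3.15::real)^3" using pi_approx by (intro power_mono) auto
    then have "2 * pi^3 \<le> (64::real)" by (simp add: power3_eq_cube)
    then show ?thesis using y4 pos by (intro mult_mono mult_right_mono) auto
  qed
  ultimately have "U y \<le> \<kappa> + 4 * Q" unfolding U_def by linarith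
  moreover have "w y \<le> w b + U y" using max[of y] U_ge[of b] zero_le_power2[of b] by linarith
  ultimately have "\<mu> * w y \<le> \<mu> * (w b + (\<kappa> + 4*Q))" using pos by (intro mult_left_mono) auto
  then show ?thesis using wb wy by (simp add: algebra_simps)
qed

section \<open>Descent away from a stiff well\<close>

text \<open>The hypothesis \<open>stiff\<close> says that \<open>S' = \<kappa> sin (2*pi*t)\<close> is the slope of a subsolution of
  the ergodic equation at the energy \<open>E + \<epsilon>^2/2\<close>, which exceeds every value of \<open>\<mu> * w\<close>. Put \<open>v = w'\<close>. The quantity
  \<open>D = (S' - v) exp (- (w + S) / \<epsilon>)\<close> is, up to a factor \<open>\<epsilon>\<close>, the Wronskian of \<open>exp (- w / \<epsilon>)\<close> and
  \<open>exp (- S / \<epsilon>)\<close>, so its derivative is governed by the difference of the two energies and is positive.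
  If \<open>v 0 \<le> 0\<close>, then \<open>D\<close> is nonnegative at \<open>0\<close> and gains, before \<open>r\<close>, an amount which exceeds
  \<open>exp (- (w r + S r) / \<epsilon>)\<close> by a factor exponentially large in \<open>1 / \<epsilon>\<close> unless \<open>w\<close> has already begun to
  decrease. Hence \<open>v r \<le> 0\<close>. Away from the wells the Riccati equation
  \<open>\<epsilon> v' = v^2 - (F - \<mu> w)\<close> keeps \<open>v\<close> nonpositive and drives it below \<open>-1/4\<close>, which gives a drop of
  \<open>w\<close> independent of \<open>\<epsilon>\<close> and \<open>r\<close>.\<close>

lemma descent_across_stiff_well:
  fixes w v v' F :: "real \<Rightarrow> real"
  assumes w: "\<And>t. (w has_real_derivative v t) (at t)"
    and v: "\<And>t. (v has_real_derivative v' t) (at t)"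
    and eq: "\<And>t. \<mu> * w t - \<epsilon> * v' t + (v t)\<^sup>2 = F t"
    and F_ge: "\<And>t. F t \<ge> (sin (2*pi*t))\<^sup>2"
    and w_le: "\<And>t. \<mu> * w t \<le> E"
    and stiff: "\<And>t. \<bar>t\<bar> \<le> 1/4 \<Longrightarrow>
        F t \<ge> \<kappa>\<^sup>2 * (sin (2*pi*t))\<^sup>2 - 2*pi*\<kappa>*\<epsilon> * cos (2*pi*t) + E + \<epsilon>\<^sup>2/2"
    and \<kappa>: "1 \<le> \<kappa>" "\<kappa> \<le> 2"
    and r: "0 < r" "r \<le> 1/8"
    and small: "0 < \<epsilon>" "\<epsilon> < 1/32" "E \<le> 8*\<epsilon>" "8*\<epsilon> < (sin (pi*r))\<^sup>2"
      "128*pi\<^sup>2*\<epsilon> < r * (cos (3*pi*r/2) - cos (2*pi*r))\<^sup>2"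
    and v0: "v 0 \<le> 0"
  shows "w r - w (1/2 - r) \<ge> 1/32"
proof -
  have gap: "F t - \<mu> * w t \<ge> (sin (2*pi*t))\<^sup>2 - 8*\<epsilon>" for t
    using F_ge[of t] w_le[of t] small(3) by linarith
  have v'_eq: "v' t = ((v t)\<^sup>2 - (F t - \<mu> * w t)) / \<epsilon>" for t
    using eq[of t] small(1) by (simp add: field_simps)
  have v'_neg: "v' t < 0" if "(v t)\<^sup>2 < F t - \<mu> * w t" for t
    unfolding v'_eq using that small(1) by (simp add: divide_neg_pos)
  have sin_ge: "(sin (2*pi * s))\<^sup>2 \<le> (sin (2*pi*t))\<^sup>2" if "0 \<le> s" "s \<le> t" "t \<le> 1/2 - s" for s t
  proof -
    have s0: "- (pi/2) \<le> 2*pi * s" by (rule order_trans[of _ 0]) (use that in auto)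
    have "sin (2*pi * s) \<le> sin (2*pi*t)"
    proof (cases "t \<le> 1/4")
      case True
      then show ?thesis using that by (intro sin_monotone_2pi_le s0) (auto simp: mult_le_cancel_left_pos)
    next
      case False
      have "sin (2*pi * s) \<le> sin (2*pi*(1/2 - t))"
      proof (rule sin_monotone_2pi_le[OF s0])
        show "2*pi * s \<le> 2*pi*(1/2 - t)" using that by (intro mult_left_mono) auto
        have "2*pi*(1/2 - t) \<le> 2*pi*(1/4)" using False by (intro mult_left_mono) auto
        then show "2*pi*(1/2 - t) \<le> pi/2" by simp
      qed
      also have "\<dots> = sin (2*pi*t)" by (simp add: right_diff_distrib)
      finally show ?thesis .
    qed
    moreover have "0 \<le> sin (2*pi * s)" using that by (intro sin_ge_zero) auto
    ultimately show ?thesis by (intro power_mono)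
  qed
  have away: "F t - \<mu> * w t > 0" if "r/2 \<le> t" "t \<le> 1/2 - r/2" for t
    using gap[of t] sin_ge[of "r/2" t] that r small(4) by (simp add: mult.commute)
  have stays: "v t \<le> 0" if "r/2 \<le> s" "v s \<le> 0" "s \<le> t" "t \<le> 1/2 - r/2" for s t
    using barrier_from_above[of v v' s 0 "1/2 - r/2" t] v v'_neg away that by auto
  define S where "S t = - \<kappa> * cos (2*pi*t) / (2*pi)" for t :: real
  define D where "D t = (\<kappa> * sin (2*pi*t) - v t) * exp (- (w t + S t) / \<epsilon>)" for t
  define D' where "D' t = (2*pi*\<kappa>*\<epsilon> * cos (2*pi*t) - \<kappa>\<^sup>2 * (sin (2*pi*t))\<^sup>2 + F t - \<mu> * w t) / \<epsilon>
      * exp (- (w t + S t) / \<epsilon>)" for t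
  have S: "(S has_real_derivative \<kappa> * sin (2*pi*t)) (at t)" for t
    unfolding S_def by (auto intro!: derivative_eq_intros)
  have D: "(D has_real_derivative D' t) (at t)" for t
  proof -
    have *: "(D has_real_derivative ((2*pi*\<kappa> * cos (2*pi*t) - v' t) * exp (- (w t + S t) / \<epsilon>)
        + (\<kappa> * sin (2*pi*t) - v t) * (exp (- (w t + S t) / \<epsilon>) * (- (v t + \<kappa> * sin (2*pi*t)) / \<epsilon>)))) (at t)"
    proof -
      have "((\<lambda>t. exp (- (w t + S t) / \<epsilon>)) has_real_derivative
          exp (- (w t + S t) / \<epsilon>) * (- (v t + \<kappa> * sin (2*pi*t)) / \<epsilon>)) (at t)"
        by (intro DERIV_fun_exp DERIV_cdivide DERIV_minus DERIV_add w S)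
      moreover have "((\<lambda>t. \<kappa> * sin (2*pi*t) - v t) has_real_derivative
          2*pi*\<kappa> * cos (2*pi*t) - v' t) (at t)"
        by (auto intro!: derivative_eq_intros v)
      ultimately show ?thesis
        unfolding D_def using DERIV_mult by (fastforce simp: algebra_simps)
    qed
    have "(2*pi*\<kappa>*\<epsilon> * cos (2*pi*t) - \<kappa>\<^sup>2 * (sin (2*pi*t))\<^sup>2 + F t - \<mu> * w t) / \<epsilon>
       = (2*pi*\<kappa> * cos (2*pi*t) - v' t) + (\<kappa> * sin (2*pi*t) - v t) * (- (v t + \<kappa> * sin (2*pi*t)) / \<epsilon>)"
      using small(1) unfolding v'_eq by (simp add: field_simps power2_eq_square)
    moreover have "(x + y * z) * X = x * X + y * (X * z)" for x y z X :: real
      by (simp add: algebra_simps)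
    ultimately have "D' t = (2*pi*\<kappa> * cos (2*pi*t) - v' t) * exp (- (w t + S t) / \<epsilon>)
        + (\<kappa> * sin (2*pi*t) - v t) * (exp (- (w t + S t) / \<epsilon>) * (- (v t + \<kappa> * sin (2*pi*t)) / \<epsilon>))"
      unfolding D'_def by presburger
    with * show ?thesis by metis
  qed
  have D'_ge: "D' t \<ge> \<epsilon>/2 * exp (- (w t + S t) / \<epsilon>)" if "\<bar>t\<bar> \<le> 1/4" for t
    unfolding D'_def
  proof (rule mult_right_mono)
    show "\<epsilon>/2 \<le> (2*pi*\<kappa>*\<epsilon> * cos (2*pi*t) - \<kappa>\<^sup>2 * (sin (2*pi*t))\<^sup>2 + F t - \<mu> * w t) / \<epsilon>"
      using stiff[OF that] w_le[of t] small(1) by (simp add: field_simps power2_eq_square)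
  qed simp
  have D'_nonneg: "D' t \<ge> 0" if "\<bar>t\<bar> \<le> 1/4" for t
    using D'_ge[OF that] small(1) by (smt (verit) exp_gt_zero half_gt_zero mult_pos_pos)
  have D_mono: "D s \<le> D t" if "0 \<le> s" "s \<le> t" "t \<le> 1/4" for s t
    using DERIV_nonneg_imp_nondecreasing[OF that(2), of D] D D'_nonneg that by fastforce
  have "v r \<le> 0"
  proof (rule ccontr)
    assume pos: "\<not> v r \<le> 0"
    have v_pos: "v t \<ge> 0" if "r/2 \<le> t" "t \<le> r" for t
      using stays[of t r] that pos r by force
    have w_mono: "w t \<le> w r" if "r/2 \<le> t" "t \<le> r" for t
      using DERIV_nonneg_imp_nondecreasing[OF that(2), of w] w v_pos that by fastforce
    have S_mono: "S t \<le> S (3*r/4)" if "r/2 \<le> t" "t \<le> 3*r/4" for t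
    proof -
      have "cos (2*pi*(3*r/4)) \<le> cos (2*pi*t)"
      proof (rule cos_monotone_0_pi_le)
        show "2*pi*(3*r/4) \<le> pi" using r by simp
      qed (use that r in auto)
      then show ?thesis unfolding S_def using \<kappa> by (simp add: divide_le_cancel mult_le_cancel_left_pos)
    qed
    have "r/2 < 3*r/4" using r by simp
    then obtain z where z: "r/2 < z" "z < 3*r/4" "D (3*r/4) - D (r/2) = (3*r/4 - r/2) * D' z"
      using MVT2[of "r/2" "3*r/4" D D'] D by blast
    \<comment> \<open>\<open>A\<close> is a lower bound for the exponential factor on \<open>[r/2, 3*r/4]\<close>; at \<open>r\<close> that factor is
        smaller than \<open>A\<close> by the factor \<open>exp ((S r - S (3*r/4)) / \<epsilon>)\<close>.\<close>
    define A where "A = exp (- (w r + S (3*r/4)) / \<epsilon>)"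
    have "D 0 \<ge> 0" using v0 by (simp add: D_def mult_nonpos_nonneg)
    then have D_half: "D (r/2) \<ge> 0" using D_mono[of 0 "r/2"] r by simp
    have "\<epsilon>/2 * A \<le> \<epsilon>/2 * exp (- (w z + S z) / \<epsilon>)"
      unfolding A_def using w_mono[of z] S_mono[of z] z r small(1) 
      by (auto intro!: mult_left_mono divide_right_mono)
    also have "\<dots> \<le> D' z" using D'_ge[of z] z r by auto
    finally have "(r/4) * (\<epsilon>/2 * A) \<le> (r/4) * D' z" using r by (intro mult_left_mono) auto
    also have "\<dots> = D (3*r/4) - D (r/2)" using z by simp
    also have "\<dots> \<le> D r" using D_half D_mono[of "3*r/4" r] r by simp
    also have "\<dots> \<le> 2 * exp (- (w r + S r) / \<epsilon>)"
      unfolding D_def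
    proof (rule mult_right_mono)
      have "\<kappa> * sin (2*pi*r) \<le> 2 * 1" using \<kappa> by (intro mult_mono sin_le_one) (use r in \<open>auto intro!: sin_ge_zero\<close>)
      then show "\<kappa> * sin (2*pi*r) - v r \<le> 2" using pos by simp
    qed simp
    also have "\<dots> = 2 * A * exp (- (S r - S (3*r/4)) / \<epsilon>)"
    proof -
      have "- (w r + S r) / \<epsilon> = - (w r + S (3*r/4)) / \<epsilon> + - (S r - S (3*r/4)) / \<epsilon>"
        by (simp add: add_divide_distrib[symmetric])
      then show ?thesis unfolding A_def by (simp only: exp_add mult.assoc)
    qed
    finally have "(r/4) * (\<epsilon>/2 * A) \<le> 2 * A * exp (- (S r - S (3*r/4)) / \<epsilon>)" .
    then have "A * (r * \<epsilon>) \<le> A * (16 * exp (- ((S r - S (3*r/4)) / \<epsilon>)))"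
      by (simp add: minus_divide_left algebra_simps)
    then have "r * \<epsilon> \<le> 16 * exp (- ((S r - S (3*r/4)) / \<epsilon>))" by (simp add: A_def)
    then have rE: "r * \<epsilon> * exp ((S r - S (3*r/4)) / \<epsilon>) \<le> 16"
      by (simp add: exp_minus field_simps)
    define c where "c = (cos (3*pi*r/2) - cos (2*pi*r)) / (2*pi)"
    have "cos (2*pi*r) \<le> cos (3*pi*r/2)" using r by (intro cos_monotone_0_pi_le) auto
    then have c0: "c \<ge> 0" by (simp add: c_def)
    have "S r - S (3*r/4) = \<kappa> * c" by (simp add: S_def c_def field_simps)
    then have "c \<le> S r - S (3*r/4)" using \<kappa> c0 by (metis mult_cancel_right1 mult_right_mono)
    then have "c/\<epsilon> \<le> (S r - S (3*r/4)) / \<epsilon>" using small by (simp add: divide_right_mono)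
    then have "exp (c/\<epsilon>) \<le> exp ((S r - S (3*r/4)) / \<epsilon>)" by simp
    moreover have "(c/\<epsilon>)\<^sup>2 / 2 \<le> exp (c/\<epsilon>)"
      using exp_lower_Taylor_quadratic[of "c/\<epsilon>"] c0 small by (smt (verit) divide_nonneg_pos)
    ultimately have "(c/\<epsilon>)\<^sup>2/2 \<le> exp ((S r - S (3*r/4)) / \<epsilon>)" by linarith
    then have "r * \<epsilon> * ((c/\<epsilon>)\<^sup>2/2) \<le> r * \<epsilon> * exp ((S r - S (3*r/4)) / \<epsilon>)"
      using r small by (intro mult_left_mono) auto
    then have "r * \<epsilon> * ((c/\<epsilon>)\<^sup>2/2) \<le> 16" using rE by linarith
    then have "r * c\<^sup>2 \<le> 32 * \<epsilon>" using small(1) by (simp add: power2_eq_square field_simps)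
    then show False using small(5) by (simp add: c_def power_divide field_simps power_mult_distrib)
  qed
  have v_nonpos: "v t \<le> 0" if "r \<le> t" "t \<le> 1/2 - r" for t
    using stays[of r t] \<open>v r \<le> 0\<close> that r by simp
  have middle: "F t - \<mu> * w t \<ge> 1/4" if "1/8 \<le> t" "t \<le> 3/8" for t
  proof -
    have "sin (2*pi*(1/8)) = sqrt 2 / 2" using sin_45 by (simp add: field_simps)
    then have "(sin (2*pi*(1/8)))\<^sup>2 = 1/2" by (simp only: power_divide) simp
    then show ?thesis using sin_ge[of "1/8" t] gap[of t] small(2) that by auto
  qed
  \<comment> \<open>Where \<open>-1/4 < v \<le> 0\<close>, the slope of \<open>v\<close> is at most \<open>-3 / (16 * \<epsilon>)\<close>, so this range is left quickly.\<close>
  have "\<exists>s. 1/8 \<le> s \<and> s \<le> 1/4 \<and> v s \<le> -1/4"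
  proof (rule ccontr)
    assume "\<not> ?thesis"
    then have low: "v s > -1/4" if "1/8 \<le> s" "s \<le> 1/4" for s using that by force
    obtain z where z: "1/8 < z" "z < 1/4" "v (1/4) - v (1/8) = (1/4 - 1/8) * v' z"
      using MVT2[of "1/8" "1/4" v v'] v by auto
    have "\<bar>v z\<bar> \<le> 1/4" using low[of z] v_nonpos[of z] z r by simp
    then have "(v z)\<^sup>2 \<le> 1/16" using power_mono[of "\<bar>v z\<bar>" "1/4" 2] by (simp add: power2_eq_square)
    then have "\<epsilon> * v' z \<le> -3/16" using middle[of z] z small(1) unfolding v'_eq by simp
    moreover have "v' z > -2" using z low[of "1/4"] v_nonpos[of "1/8"] r by simp
    then have "\<epsilon> * v' z > \<epsilon> * (-2)" using small(1) by (intro mult_strict_left_mono)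
    ultimately show False using small(2) by simp
  qed
  then obtain s where s: "1/8 \<le> s" "s \<le> 1/4" "v s \<le> -1/4" by blast
  have steep: "v t \<le> -1/4" if "1/4 \<le> t" "t \<le> 3/8" for t
  proof (rule barrier_from_above[of v v' s "-1/4" "3/8"])
    show "v' t < 0" if "s \<le> t" "t \<le> 3/8" "v t = -1/4" for t
      using v'_neg[of t] middle[of t] that s by (simp add: power2_eq_square)
  qed (use v s that in auto)
  obtain z where z: "1/4 < z" "z < 3/8" "w (3/8) - w (1/4) = (3/8 - 1/4) * v z"
    using MVT2[of "1/4" "3/8" w v] w by auto
  have "w (3/8) \<le> w (1/4) - 1/32" using z steep[of z] by simp
  moreover have mono: "w t \<le> w s" if "r \<le> s" "s \<le> t" "t \<le> 1/2 - r" for s t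
    using DERIV_nonpos_imp_nonincreasing[OF that(2), of w] w v_nonpos that by fastforce
  have "w (1/4) \<le> w r" "w (1/2 - r) \<le> w (3/8)" using r by (auto intro!: mono)
  ultimately show ?thesis by simp
qed

section \<open>Bumps that stiffen one well above a given length scale\<close>

lemma C2_series:
  fixes f f1 f2 :: "nat \<Rightarrow> real \<Rightarrow> real" and M :: "nat \<Rightarrow> real"
  assumes f: "\<And>j x. (f j has_real_derivative f1 j x) (at x)"
    and f1: "\<And>j x. (f1 j has_real_derivative f2 j x) (at x)"
    and f2: "\<And>j. continuous_on UNIV (f2 j)"
    and bounds: "\<And>j x. \<bar>f j x\<bar> \<le> M j" "\<And>j x. \<bar>f1 j x\<bar> \<le> M j" "\<And>j x. \<bar>f2 j x\<bar> \<le> M j"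
    and M: "summable M"
  shows "((\<lambda>x. \<Sum>j. f j x) has_real_derivative (\<Sum>j. f1 j x)) (at x)"
    and "((\<lambda>x. \<Sum>j. f1 j x) has_real_derivative (\<Sum>j. f2 j x)) (at x)"
    and "continuous_on UNIV (\<lambda>x. \<Sum>j. f2 j x)"
proof -
  have unif: "uniform_limit UNIV (\<lambda>n x. \<Sum>j<n. g j x) (\<lambda>x. \<Sum>j. g j x) sequentially"
    if "\<And>j x. \<bar>g j x\<bar> \<le> M j" for g :: "nat \<Rightarrow> real \<Rightarrow> real"
    using Weierstrass_m_test[of UNIV g M] that M by simp
  have sm: "summable (\<lambda>j. g j x)" if "\<And>j x. \<bar>g j x\<bar> \<le> M j" for g :: "nat \<Rightarrow> real \<Rightarrow> real" and x
    using summable_comparison_test'[OF M, of 0 "\<lambda>j. g j x"] that by simp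
  have "uniformly_convergent_on UNIV (\<lambda>n x. \<Sum>j<n. f1 j x)"
       "uniformly_convergent_on UNIV (\<lambda>n x. \<Sum>j<n. f2 j x)"
    using unif bounds unfolding uniformly_convergent_on_def by blast+
  then show "((\<lambda>x. \<Sum>j. f j x) has_real_derivative (\<Sum>j. f1 j x)) (at x)"
    "((\<lambda>x. \<Sum>j. f1 j x) has_real_derivative (\<Sum>j. f2 j x)) (at x)"
    using has_field_derivative_series'(2)[of UNIV f f1 0 x]
      has_field_derivative_series'(2)[of UNIV f1 f2 0 x] f f1 sm bounds by simp_all
  show "continuous_on UNIV (\<lambda>x. \<Sum>j. f2 j x)"
  proof (rule uniform_limit_theorem[OF _ unif])
    show "\<forall>\<^sub>F n in sequentially. continuous_on UNIV (\<lambda>x. \<Sum>j<n. f2 j x)"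
      by (intro always_eventually allI continuous_intros f2)
  qed (use bounds in auto)
qed

text \<open>With \<open>s = 1\<close> the bump acts on the well at \<open>0\<close>, with \<open>s = -1\<close> on the well at \<open>1/2\<close>. Near its own well,
  with \<open>y = sin (2*pi*x)\<close>, it behaves like \<open>y^4 / (y^2/2 + \<sigma>)\<close>: comparable with \<open>y^2\<close> at distances well above
  \<open>sqrt \<sigma>\<close>, but of fourth order at the well, so that it changes no second derivative there.
  Near the other well it is of fourth order uniformly in \<open>\<sigma>\<close>. The denominator is chosen because
  \<open>y^2 = (1 - s cos (2*pi*x)) (1 + s cos (2*pi*x))\<close>, which makes all bounds
  algebraic.\<close>

definition well_bump :: "real \<Rightarrow> real \<Rightarrow> real \<Rightarrow> real" where
  "well_bump s \<sigma> x = sin (2*pi*x) ^ 4 / (1 - s * cos (2*pi*x) + \<sigma>)"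

lemma bump_denominator:
  fixes \<theta> :: real
  assumes "\<bar>s\<bar> = 1" "\<sigma> > 0"
  shows "1 - s * cos \<theta> + \<sigma> \<ge> \<sigma>" "1 - s * cos \<theta> + \<sigma> > 0"
    and "(sin \<theta>)\<^sup>2 = (1 - s * cos \<theta>) * (1 + s * cos \<theta>)"
    and "(sin \<theta>)\<^sup>2 \<le> 2 * (1 - s * cos \<theta> + \<sigma>)"
proof -
  have s: "s = 1 \<or> s = -1" using assms by linarith
  have c: "\<bar>s * cos \<theta>\<bar> \<le> 1" using s by (auto simp: abs_mult)
  show D: "1 - s * cos \<theta> + \<sigma> \<ge> \<sigma>" using c by linarith
  then show "1 - s * cos \<theta> + \<sigma> > 0" using assms by linarith
  show eq: "(sin \<theta>)\<^sup>2 = (1 - s * cos \<theta>) * (1 + s * cos \<theta>)"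
    using s sin_cos_squared_add[of \<theta>] by (auto simp: power2_eq_square algebra_simps)
  have "(1 - s * cos \<theta>) * (1 + s * cos \<theta>) \<le> (1 - s * cos \<theta>) * 2"
    using c by (intro mult_left_mono) linarith+
  then have "(sin \<theta>)\<^sup>2 \<le> (1 - s * cos \<theta>) * 2" by (simp only: eq)
  then show "(sin \<theta>)\<^sup>2 \<le> 2 * (1 - s * cos \<theta> + \<sigma>)" using assms(2) by (simp add: algebra_simps)
qed

lemma well_bump_nonneg: "\<bar>s\<bar> = 1 \<Longrightarrow> \<sigma> > 0 \<Longrightarrow> well_bump s \<sigma> x \<ge> 0"
  unfolding well_bump_def using bump_denominator(2)[of s \<sigma> "2*pi*x"] by simp

lemma well_bump_le_twice:
  assumes "\<bar>s\<bar> = 1" "\<sigma> > 0"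
  shows "well_bump s \<sigma> x \<le> 2 * (sin (2*pi*x))\<^sup>2"
proof -
  note D = bump_denominator[OF assms, of "2*pi*x"]
  have "sin (2*pi*x) ^ 4 = (sin (2*pi*x))\<^sup>2 * (sin (2*pi*x))\<^sup>2" by (simp add: eval_nat_numeral)
  also have "\<dots> \<le> (sin (2*pi*x))\<^sup>2 * (2 * (1 - s * cos (2*pi*x) + \<sigma>))"
    using D(4) by (intro mult_left_mono) auto
  finally show ?thesis unfolding well_bump_def using D(2) by (simp add: pos_divide_le_eq algebra_simps)
qed

text \<open>The loss against a full quadratic bump is the constant \<open>2 * \<sigma>\<close>, not a multiple of \<open>y^2\<close>; as a constant it
  merely shifts the energy.\<close>

lemma well_bump_ge_square:
  assumes "\<bar>s\<bar> = 1" "\<sigma> > 0" and near: "s * cos (2*pi*x) \<ge> 0"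
  shows "well_bump s \<sigma> x \<ge> (sin (2*pi*x))\<^sup>2 - 2 * \<sigma>"
proof -
  note D = bump_denominator[OF assms(1,2), of "2*pi*x"]
  define y2 d T where "y2 = (sin (2*pi*x))\<^sup>2" and "d = 1 - s * cos (2*pi*x) + \<sigma>"
    and "T = 1 - s * cos (2*pi*x)"
  have "T \<ge> 0" using D(1) by (simp add: T_def)
  then have "T * (1 + s * cos (2*pi*x)) \<ge> T * 1" using near by (intro mult_left_mono) auto
  moreover have "y2 = T * (1 + s * cos (2*pi*x))" using D(3) by (simp only: y2_def T_def)
  ultimately have "y2 - d \<ge> - \<sigma>" by (simp add: T_def d_def)
  then have "y2 * (y2 - d) \<ge> y2 * (- \<sigma>)" by (intro mult_left_mono) (auto simp: y2_def)
  moreover have "2 * \<sigma> * d \<ge> \<sigma> * y2"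
    using mult_left_mono[OF D(4), of \<sigma>] assms unfolding y2_def d_def by (simp add: algebra_simps)
  ultimately have "(y2 - 2 * \<sigma>) * d \<le> y2 * y2" by (simp add: algebra_simps)
  then have "y2 - 2 * \<sigma> \<le> y2 * y2 / d" using D(2) by (simp add: pos_le_divide_eq d_def)
  then show ?thesis by (simp add: well_bump_def y2_def d_def eval_nat_numeral)
qed

lemma sin_power_le:
  fixes \<theta> :: real
  shows "(sin \<theta>)\<^sup>2 \<le> \<theta>\<^sup>2" "sin \<theta> ^ 4 \<le> \<theta>^4"
proof -
  show "(sin \<theta>)\<^sup>2 \<le> \<theta>\<^sup>2" using abs_sin_x_le_abs_x[of \<theta>] by (simp add: abs_le_square_iff)
  have "\<bar>sin \<theta>\<bar>^4 \<le> \<bar>\<theta>\<bar>^4" by (intro power_mono abs_sin_x_le_abs_x) auto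
  then show "sin \<theta> ^ 4 \<le> \<theta>^4" by simp
qed

lemma well_bump_le_quartic:
  assumes "\<bar>s\<bar> = 1" "\<sigma> > 0" and \<theta>: "(sin (2*pi*x))\<^sup>2 = (sin \<theta>)\<^sup>2"
  shows "well_bump s \<sigma> x \<le> \<theta>^4 / \<sigma>"
proof -
  have "sin (2*pi*x) ^ 4 = sin \<theta> ^ 4" using arg_cong[OF \<theta>, of "\<lambda>z. z\<^sup>2"] by simp
  then show ?thesis
    unfolding well_bump_def using bump_denominator[OF assms(1,2), of "2*pi*x"] sin_power_le(2)[of \<theta>] assms(2)
    by (intro frac_le) auto
qed

text \<open>Here \<open>\<theta>\<close> is the angle measured from the other well. Where \<open>cos \<theta> \<ge> 0\<close> the denominator is at least 1;
  elsewhere \<open>\<theta>^4\<close> exceeds the global bound 2 of the bump.\<close>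

lemma well_bump_le_quartic_far:
  assumes "\<bar>s\<bar> = 1" "\<sigma> > 0" and \<theta>: "(sin (2*pi*x))\<^sup>2 = (sin \<theta>)\<^sup>2" "s * cos (2*pi*x) = - cos \<theta>"
  shows "well_bump s \<sigma> x \<le> \<theta>^4"
proof (cases "cos \<theta> \<ge> 0")
  case True
  have "sin (2*pi*x) ^ 4 = sin \<theta> ^ 4" using arg_cong[OF \<theta>(1), of "\<lambda>z. z\<^sup>2"] by simp
  then have "well_bump s \<sigma> x \<le> \<theta>^4 / 1"
    unfolding well_bump_def using True assms sin_power_le(2)[of \<theta>] by (intro frac_le) auto
  then show ?thesis by simp
next
  case False
  then have "\<bar>\<theta>\<bar> > pi/2" using cos_ge_zero[of \<theta>] by linarith
  then have "\<bar>\<theta>\<bar> \<ge> 3/2" using pi_gt3 by simp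
  then have "\<bar>\<theta>\<bar>^4 \<ge> (3/2)^4" by (intro power_mono) auto
  moreover have "(sin (2*pi*x))\<^sup>2 \<le> 1" by (simp add: abs_square_le_1)
  ultimately show ?thesis using well_bump_le_twice[OF assms(1,2), of x] by (simp add: eval_nat_numeral)
qed

definition bump_deriv :: "real \<Rightarrow> real \<Rightarrow> real \<Rightarrow> real" where
  "bump_deriv s \<sigma> x = (let y = sin (2*pi*x); c = cos (2*pi*x); d = 1 - s * c + \<sigma> in
     2*pi * (4 * y^3 * c / d - s * y^5 / d\<^sup>2))"

definition bump_deriv2 :: "real \<Rightarrow> real \<Rightarrow> real \<Rightarrow> real" where
  "bump_deriv2 s \<sigma> x = (let y = sin (2*pi*x); c = cos (2*pi*x); d = 1 - s * c + \<sigma> in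
     (2*pi)\<^sup>2 * ((12 * y\<^sup>2 * c\<^sup>2 - 4 * y^4) / d - 9 * s * c * y^4 / d\<^sup>2 + 2 * y^6 / d^3))"

lemma well_bump_derivatives:
  assumes "\<bar>s\<bar> = 1" "\<sigma> > 0"
  shows "(well_bump s \<sigma> has_real_derivative bump_deriv s \<sigma> x) (at x)"
    and "(bump_deriv s \<sigma> has_real_derivative bump_deriv2 s \<sigma> x) (at x)"
    and "continuous_on UNIV (bump_deriv2 s \<sigma>)"
proof -
  define y c d :: "real \<Rightarrow> real"
    where "y x = sin (2*pi*x)" and "c x = cos (2*pi*x)" and "d x = 1 - s * cos (2*pi*x) + \<sigma>" for x
  have D: "d x \<noteq> 0" for x
    using bump_denominator(2)[OF assms, of "2*pi*x"] by (simp add: d_def)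
  have s2: "s * s = 1" using assms(1) by (metis abs_mult_self_eq mult_1)
  have y: "(y has_real_derivative 2*pi * c x) (at x)"
    and c: "(c has_real_derivative - 2*pi * y x) (at x)"
    and d: "(d has_real_derivative s * (2*pi * y x)) (at x)" for x
    unfolding y_def c_def d_def by (auto intro!: derivative_eq_intros)
  have *: "well_bump s \<sigma> = (\<lambda>x. y x^4 / d x)"
    "bump_deriv s \<sigma> = (\<lambda>x. 2*pi * (4 * y x^3 * c x / d x - s * y x^5 / (d x)\<^sup>2))"
    "bump_deriv2 s \<sigma> = (\<lambda>x. (2*pi)\<^sup>2 * ((12 * (y x)\<^sup>2 * (c x)\<^sup>2 - 4 * y x^4) / d x
       - 9 * s * c x * y x^4 / (d x)\<^sup>2 + (s * s) * 2 * y x^6 / (d x)^3))"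
    by (auto simp: well_bump_def bump_deriv_def bump_deriv2_def Let_def y_def c_def d_def s2)
  show "(well_bump s \<sigma> has_real_derivative bump_deriv s \<sigma> x) (at x)"
    unfolding *
    by (rule derivative_eq_intros refl D y c d)+
       (simp add: D field_simps power2_eq_square eval_nat_numeral)
  show "(bump_deriv s \<sigma> has_real_derivative bump_deriv2 s \<sigma> x) (at x)"
    unfolding *
    by (rule derivative_eq_intros refl D y c d | simp add: D)+
       (simp add: D field_simps power2_eq_square eval_nat_numeral)
  have "continuous_on UNIV y" "continuous_on UNIV c" "continuous_on UNIV d"
    unfolding y_def c_def d_def by (intro continuous_intros)+
  then show "continuous_on UNIV (bump_deriv2 s \<sigma>)"
    unfolding * using D by (intro continuous_intros ballI) auto
qed

text \<open>Both derivatives are polynomials in \<open>y\<close>, \<open>c\<close> and the quotient \<open>u = y^2 / d\<close>, and \<open>0 \<le> u \<le> 2\<close> whatever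
  \<open>\<sigma>\<close> is. This uniformity lets bumps of arbitrarily small width be summed within \<open>C^2\<close>.\<close>

lemma bump_derivative_bounds:
  assumes "\<bar>s\<bar> = 1" "\<sigma> > 0"
  shows "\<bar>bump_deriv s \<sigma> x\<bar> \<le> 4000" and "\<bar>bump_deriv2 s \<sigma> x\<bar> \<le> 4000"
proof -
  define y c d u where "y = sin (2*pi*x)" and "c = cos (2*pi*x)" and "d = 1 - s * c + \<sigma>"
    and "u = y\<^sup>2 / d"
  have d: "d > 0" and yd: "y\<^sup>2 \<le> 2 * d"
    using bump_denominator[OF assms, of "2*pi*x"] by (simp_all add: y_def c_def d_def)
  have u: "0 \<le> u" "u \<le> 2" using d yd by (simp_all add: u_def divide_le_eq)
  have y1: "\<bar>y\<bar> \<le> 1" "y\<^sup>2 \<le> 1" and c1: "\<bar>c\<bar> \<le> 1" "c\<^sup>2 \<le> 1"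
    by (simp_all add: y_def c_def abs_square_le_1)
  have uu: "u\<^sup>2 \<le> 4" "u^3 \<le> 8" using power_mono[OF u(2,1), of 2] power_mono[OF u(2,1), of 3] by simp_all
  have "bump_deriv s \<sigma> x = 2*pi * (4 * (y * c * u) - s * y * u\<^sup>2)"
    unfolding bump_deriv_def Let_def u_def y_def[symmetric] c_def[symmetric] d_def[symmetric]
    using d by (simp add: field_simps power2_eq_square eval_nat_numeral)
  moreover have "\<bar>y * c * u\<bar> \<le> 1 * 1 * 2"
    unfolding abs_mult using y1 c1 u by (intro mult_mono) auto
  moreover have "\<bar>s * y * u\<^sup>2\<bar> \<le> 1 * 1 * 4"
    unfolding abs_mult using y1 u uu assms by (intro mult_mono) auto
  moreover from calculation have "\<bar>4 * (y * c * u) - s * y * u\<^sup>2\<bar> \<le> 12" by linarith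
  ultimately have "\<bar>bump_deriv s \<sigma> x\<bar> \<le> 2*pi * 12"
    by (simp add: abs_mult)
  then show "\<bar>bump_deriv s \<sigma> x\<bar> \<le> 4000" using pi_less_4 by simp
  have "bump_deriv2 s \<sigma> x = (2*pi)\<^sup>2 * (12 * (c\<^sup>2 * u) - 4 * (y\<^sup>2 * u) - 9 * (s * c * u\<^sup>2) + 2 * u^3)"
    unfolding bump_deriv2_def Let_def u_def y_def[symmetric] c_def[symmetric] d_def[symmetric]
    using d by (simp add: field_simps power2_eq_square eval_nat_numeral)
  moreover have "\<bar>12 * (c\<^sup>2 * u) - 4 * (y\<^sup>2 * u) - 9 * (s * c * u\<^sup>2) + 2 * u^3\<bar> \<le> 84"
  proof -
    have "\<bar>c\<^sup>2 * u\<bar> \<le> 1 * 2" unfolding abs_mult using c1 u by (intro mult_mono) auto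
    moreover have "\<bar>y\<^sup>2 * u\<bar> \<le> 1 * 2" unfolding abs_mult using y1 u by (intro mult_mono) auto
    moreover have "\<bar>s * c * u\<^sup>2\<bar> \<le> 1 * 1 * 4"
      unfolding abs_mult using c1 u uu assms by (intro mult_mono) auto
    moreover have "\<bar>u^3\<bar> \<le> 8" using uu u by simp
    ultimately show ?thesis by linarith
  qed
  moreover have "(2*pi)\<^sup>2 \<le> (6.3::real)\<^sup>2" using pi_approx by (intro power_mono) auto
  ultimately have "\<bar>bump_deriv2 s \<sigma> x\<bar> \<le> (6.3)\<^sup>2 * 84"
    by (simp only: abs_mult abs_power2) (rule mult_mono, auto)
  then show "\<bar>bump_deriv2 s \<sigma> x\<bar> \<le> 4000" by (simp add: power2_eq_square)
qed

section \<open>The double-well potential\<close>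

text \<open>Bumps with even index stiffen the well at \<open>0\<close>, those with odd index the well at \<open>1/2\<close>. The \<open>k\<close>-th bump is largely
  visible to a ground state of width \<open>sqrt (e k)\<close>, the width for \<open>\<epsilon> = e k\<close>, and it outweighs all later ones
  since \<open>2 * (16^-(k+1) + 16^-(k+2) + ...)\<close> is only \<open>2/15 * 16^-k\<close>. Earlier bumps have much larger width and are
  of fourth order at this scale.\<close>

definition potential :: "(nat \<Rightarrow> real) \<Rightarrow> real \<Rightarrow> real" where
  "potential e x = (sin (2*pi*x))\<^sup>2 + (\<Sum>j. (1/16)^j * well_bump ((-1)^j) (e j / 16) x)"

context
  fixes e :: "nat \<Rightarrow> real"
  assumes e_pos: "\<And>j. e j > 0"
begin

lemma bump_parameters: "\<bar>(-1::real)^j\<bar> = 1" "e j / 16 > 0"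
  using e_pos[of j] by (simp_all add: power_abs)

lemma well_bump_le_2: "\<bar>well_bump ((-1)^j) (e j / 16) x\<bar> \<le> 2"
proof -
  have "(sin (2*pi*x))\<^sup>2 \<le> 1" by (simp add: abs_square_le_1)
  then show ?thesis
    using well_bump_le_twice[OF bump_parameters[of j], of x] well_bump_nonneg[OF bump_parameters[of j], of x]
    by linarith
qed

lemma summable_bumps: "summable (\<lambda>j. (1/16)^j * well_bump ((-1)^j) (e j / 16) x)"
proof (rule summable_comparison_test'[where g = "\<lambda>j. (1/16)^j * 2" and N = 0])
  show "norm ((1/16)^j * well_bump ((-1)^j) (e j / 16) x) \<le> (1/16)^j * 2" for j
    using well_bump_le_2[of j x] by (simp add: abs_mult)
qed (intro summable_mult2 summable_geometric, simp)

lemma potential_ge_sin: "potential e x \<ge> (sin (2*pi*x))\<^sup>2"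
  unfolding potential_def using suminf_nonneg[OF summable_bumps, of x] well_bump_nonneg[OF bump_parameters]
  by simp

lemma potential_zero_iff: "potential e x = 0 \<longleftrightarrow> sin (2*pi*x) = 0"
proof
  assume "potential e x = 0"
  then have "(sin (2*pi*x))\<^sup>2 \<le> 0" using potential_ge_sin[of x] by simp
  then show "sin (2*pi*x) = 0" by simp
qed (simp add: potential_def well_bump_def)

lemma potential_derivatives:
  shows "(potential e has_real_derivative 4*pi * sin (2*pi*x) * cos (2*pi*x)
      + (\<Sum>j. (1/16)^j * bump_deriv ((-1)^j) (e j / 16) x)) (at x)" (is "(_ has_real_derivative ?P1 x) _")
    and "((\<lambda>x. 4*pi * sin (2*pi*x) * cos (2*pi*x)
      + (\<Sum>j. (1/16)^j * bump_deriv ((-1)^j) (e j / 16) x)) has_real_derivative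
        8*pi\<^sup>2 * ((cos (2*pi*x))\<^sup>2 - (sin (2*pi*x))\<^sup>2) + (\<Sum>j. (1/16)^j * bump_deriv2 ((-1)^j) (e j / 16) x)) (at x)"
    and "continuous_on UNIV (\<lambda>x. 8*pi\<^sup>2 * ((cos (2*pi*x))\<^sup>2 - (sin (2*pi*x))\<^sup>2)
        + (\<Sum>j. (1/16)^j * bump_deriv2 ((-1)^j) (e j / 16) x))"
proof -
  define f f1 f2 where "f j x = (1/16)^j * well_bump ((-1)^j) (e j / 16) x"
    and "f1 j x = (1/16)^j * bump_deriv ((-1)^j) (e j / 16) x"
    and "f2 j x = (1/16)^j * bump_deriv2 ((-1)^j) (e j / 16) x" for j x
  have le: "\<bar>(1/16)^j * z\<bar> \<le> (1/16)^j * 4000" if "\<bar>z\<bar> \<le> 4000" for z :: real and j :: nat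
    using that by (simp add: abs_mult)
  have "\<bar>f j x\<bar> \<le> (1/16)^j * 4000" for j x
    unfolding f_def using well_bump_le_2[of j x] by (intro le) simp
  moreover have "\<bar>f1 j x\<bar> \<le> (1/16)^j * 4000" "\<bar>f2 j x\<bar> \<le> (1/16)^j * 4000" for j x
    unfolding f1_def f2_def by (intro le bump_derivative_bounds bump_parameters)+
  moreover have "(f j has_real_derivative f1 j x) (at x)" "(f1 j has_real_derivative f2 j x) (at x)" for j x
    unfolding f_def f1_def f2_def by (intro DERIV_cmult well_bump_derivatives bump_parameters)+
  moreover have "continuous_on UNIV (f2 j)" for j
    unfolding f2_def by (intro continuous_intros well_bump_derivatives bump_parameters)
  moreover have "summable (\<lambda>j. (1/16)^j * 4000 :: real)"
    by (intro summable_mult2 summable_geometric) simp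
  ultimately have series: "((\<lambda>x. \<Sum>j. f j x) has_real_derivative (\<Sum>j. f1 j x)) (at x)"
    "((\<lambda>x. \<Sum>j. f1 j x) has_real_derivative (\<Sum>j. f2 j x)) (at x)"
    "continuous_on UNIV (\<lambda>x. \<Sum>j. f2 j x)" for x
    using C2_series[of f f1 f2 "\<lambda>j. (1/16)^j * 4000"] by blast+
  have base: "((\<lambda>x. (sin (2*pi*x))\<^sup>2) has_real_derivative 4*pi * sin (2*pi*x) * cos (2*pi*x)) (at x)"
    "((\<lambda>x. 4*pi * sin (2*pi*x) * cos (2*pi*x)) has_real_derivative
      8*pi\<^sup>2 * ((cos (2*pi*x))\<^sup>2 - (sin (2*pi*x))\<^sup>2)) (at x)" for x
    by (auto intro!: derivative_eq_intros simp: power2_eq_square algebra_simps)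
  show "(potential e has_real_derivative ?P1 x) (at x)"
    using DERIV_add[OF base(1) series(1)] unfolding potential_def[abs_def] f_def f1_def .
  show "(?P1 has_real_derivative 8*pi\<^sup>2 * ((cos (2*pi*x))\<^sup>2 - (sin (2*pi*x))\<^sup>2)
      + (\<Sum>j. (1/16)^j * bump_deriv2 ((-1)^j) (e j / 16) x)) (at x)"
    using DERIV_add[OF base(2) series(2)] unfolding f1_def f2_def .
  have "continuous_on UNIV (\<lambda>x. 8*pi\<^sup>2 * ((cos (2*pi*x))\<^sup>2 - (sin (2*pi*x))\<^sup>2))"
    by (intro continuous_intros)
  from continuous_on_add[OF this series(3)]
  show "continuous_on UNIV (\<lambda>x. 8*pi\<^sup>2 * ((cos (2*pi*x))\<^sup>2 - (sin (2*pi*x))\<^sup>2)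
        + (\<Sum>j. (1/16)^j * bump_deriv2 ((-1)^j) (e j / 16) x))"
    unfolding f2_def .
qed

lemma deriv_potential:
  "deriv (potential e) = (\<lambda>x. 4*pi * sin (2*pi*x) * cos (2*pi*x)
      + (\<Sum>j. (1/16)^j * bump_deriv ((-1)^j) (e j / 16) x))"
  "deriv (deriv (potential e)) = (\<lambda>x. 8*pi\<^sup>2 * ((cos (2*pi*x))\<^sup>2 - (sin (2*pi*x))\<^sup>2)
      + (\<Sum>j. (1/16)^j * bump_deriv2 ((-1)^j) (e j / 16) x))"
proof -
  show 1: "deriv (potential e) = (\<lambda>x. 4*pi * sin (2*pi*x) * cos (2*pi*x)
      + (\<Sum>j. (1/16)^j * bump_deriv ((-1)^j) (e j / 16) x))"
    by (intro ext DERIV_imp_deriv potential_derivatives)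
  show "deriv (deriv (potential e)) = (\<lambda>x. 8*pi\<^sup>2 * ((cos (2*pi*x))\<^sup>2 - (sin (2*pi*x))\<^sup>2)
      + (\<Sum>j. (1/16)^j * bump_deriv2 ((-1)^j) (e j / 16) x))"
    unfolding 1 by (intro ext DERIV_imp_deriv potential_derivatives)
qed

lemma potential_C2: "potential e \<in> C2_torus"
  unfolding C2_torus_def
proof (intro CollectI conjI allI)
  have "sin (2*pi*(x+1)) = sin (2*pi*x)" "cos (2*pi*(x+1)) = cos (2*pi*x)" for x
    by (simp_all add: distrib_left)
  then show "periodic1 (potential e)"
    unfolding periodic1_def potential_def well_bump_def by presburger
  show "potential e field_differentiable at x" for x
    using potential_derivatives(1) field_differentiable_def by blast
  show "deriv (potential e) field_differentiable at x" for x
    using potential_derivatives(2) unfolding deriv_potential(1) field_differentiable_def by blast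
  show "continuous_on UNIV (deriv (deriv (potential e)))"
    unfolding deriv_potential(2) by (rule potential_derivatives)
qed

lemma potential_nondegenerate:
  assumes "potential e x = 0"
  shows "deriv (deriv (potential e)) x > 0"
proof -
  have "sin (2*pi*x) = 0" using assms potential_zero_iff by simp
  moreover from this have "(cos (2*pi*x))\<^sup>2 = 1" using sin_cos_squared_add[of "2*pi*x"] by simp
  ultimately show ?thesis
    unfolding deriv_potential(2) by (simp add: bump_deriv2_def)
qed

lemma card_potential_zeros: "card {x \<in> {0..<1}. potential e x = 0} = 2"
proof -
  have "{x \<in> {0..<1}. potential e x = 0} = {0, 1/2}"
  proof (intro set_eqI iffI)
    fix x assume x: "x \<in> {x \<in> {0..<1}. potential e x = 0}"
    then have "sin (2*pi*x) = 0" by (simp add: potential_zero_iff)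
    then obtain i :: int where "2*pi*x = of_int i * pi" using sin_zero_iff_int2 by blast
    then have i: "2 * x = of_int i" by (simp add: mult.commute)
    have "of_int i < (2::real)" "of_int i > (-1::real)" using x unfolding i[symmetric] by simp_all
    then have "i = 0 \<or> i = 1" by linarith
    then show "x \<in> {0, 1/2}" using i by auto
  next
    fix x :: real assume "x \<in> {0, 1/2}"
    then have "x = 0 \<or> x = 1/2" by blast
    then have "sin (2*pi*x) = 0" by (metis sin_pi sin_zero mult_zero_right mult.commute times_divide_eq_right nonzero_mult_div_cancel_left zero_neq_numeral mult.right_neutral)
    then show "x \<in> {x \<in> {0..<1}. potential e x = 0}"
      using \<open>x = 0 \<or> x = 1/2\<close> by (auto simp: potential_zero_iff)
  qed
  then show ?thesis by simp
qed

lemma potential_stiff_well: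
  assumes "(-1)^k * cos (2*pi*x) \<ge> 0"
  shows "potential e x \<ge> (1 + (1/16)^k) * (sin (2*pi*x))\<^sup>2 - (1/16)^k * e k / 8"
proof -
  have "(1/16)^k * well_bump ((-1)^k) (e k / 16) x \<ge> (1/16)^k * ((sin (2*pi*x))\<^sup>2 - 2 * (e k / 16))"
    using well_bump_ge_square[OF bump_parameters assms] by (intro mult_left_mono) auto
  moreover have "(\<Sum>j. (1/16)^j * well_bump ((-1)^j) (e j / 16) x) \<ge> (\<Sum>j\<in>{k}. (1/16)^j * well_bump ((-1)^j) (e j / 16) x)"
    by (intro sum_le_suminf summable_bumps) (auto intro!: mult_nonneg_nonneg well_bump_nonneg bump_parameters)
  ultimately show ?thesis unfolding potential_def by (simp add: algebra_simps)
qed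

text \<open>The angle \<open>\<theta>\<close> is measured from the well that the bump of index \<open>Suc m\<close> does not stiffen. The bumps up to index
  \<open>m\<close> contribute at most \<open>\<theta>^4 / \<sigma>\<close> each, the one of index \<open>Suc m\<close> is of fourth order
  uniformly, and the later ones may be fully quadratic but carry little weight.\<close>

lemma potential_soft_well:
  fixes \<theta> :: real
  assumes dec: "\<And>j. e (Suc j) \<le> e j" and le1: "e 0 \<le> 1"
    and \<theta>: "(sin (2*pi*x))\<^sup>2 = (sin \<theta>)\<^sup>2" "(-1)^Suc m * cos (2*pi*x) = - cos \<theta>"
  shows "potential e x \<le> (1 + 2/15 * (1/16)^Suc m) * \<theta>\<^sup>2 + 20 / e m * \<theta>^4"
proof -
  define k where "k = Suc m"
  have mono: "e n \<le> e j" if "j \<le> n" for j n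
    using lift_Suc_antimono_le[of e, OF dec that] .
  have em: "0 < e m" "e m \<le> 1" using e_pos[of m] mono[of 0 m] le1 by auto
  have inv: "1 \<le> 1 / e m" using em by simp
  define g where "g j = (if k < j then (1/16)^j * (2 * \<theta>\<^sup>2) else 0)" for j
  have termwise: "(1/16)^j * well_bump ((-1)^j) (e j / 16) x \<le> g j + (1/16)^j * (17 / e m * \<theta>^4)" for j
  proof -
    note p = bump_parameters[of j]
    have th: "0 \<le> \<theta>^4" by simp
    consider "j < k" | "j = k" | "k < j" by linarith
    then have "well_bump ((-1)^j) (e j / 16) x \<le> (if k < j then 2 * \<theta>\<^sup>2 else 0) + 17 / e m * \<theta>^4"
    proof cases
      case 1
      have "well_bump ((-1)^j) (e j / 16) x \<le> \<theta>^4 / (e j / 16)"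
        by (rule well_bump_le_quartic[OF p \<theta>(1)])
      also have "\<dots> = 16 / e j * \<theta>^4" by simp
      also have "\<dots> \<le> 17 / e m * \<theta>^4"
        using mono[of j m] 1 em e_pos[of j] by (intro mult_right_mono frac_le) (auto simp: k_def)
      finally show ?thesis using 1 by simp
    next
      case 2
      have "well_bump ((-1)^j) (e j / 16) x \<le> \<theta>^4"
        using well_bump_le_quartic_far[OF p \<theta>(1)] \<theta>(2) 2 by (simp add: k_def)
      also have "\<dots> \<le> 17 / e m * \<theta>^4" using mult_right_mono[of 1 "17 / e m" "\<theta>^4"] inv em by simp
      finally show ?thesis using 2 by simp
    next
      case 3
      have "well_bump ((-1)^j) (e j / 16) x \<le> 2 * \<theta>\<^sup>2"
        using well_bump_le_twice[OF p, of x] \<theta>(1) sin_power_le(1)[of \<theta>] by linarith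
      moreover have "0 \<le> 17 / e m * \<theta>^4" using em by simp
      ultimately show ?thesis using 3 by simp
    qed
    then have "(1/16)^j * well_bump ((-1)^j) (e j / 16) x
      \<le> (1/16)^j * ((if k < j then 2 * \<theta>\<^sup>2 else 0) + 17 / e m * \<theta>^4)"
      by (intro mult_left_mono) auto
    then show ?thesis by (cases "k < j") (simp_all add: g_def distrib_left)
  qed
  have geo: "(\<lambda>j. (1/16)^j) sums (16/15 :: real)"
    using geometric_sums[of "1/16::real"] by simp
  have "(\<lambda>j. (1/16)^j * ((1/16)^Suc k * (2 * \<theta>\<^sup>2))) sums (16/15 * ((1/16)^Suc k * (2 * \<theta>\<^sup>2)))"
    by (rule sums_mult2[OF geo])
  then have "(\<lambda>j. g (j + Suc k)) sums (16/15 * ((1/16)^Suc k * (2 * \<theta>\<^sup>2)))"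
    by (simp add: g_def power_add mult_ac)
  then have "g sums (16/15 * ((1/16)^Suc k * (2 * \<theta>\<^sup>2)))"
    by (subst (asm) sums_zero_iff_shift) (auto simp: g_def)
  then have tot: "(\<lambda>j. g j + (1/16)^j * (17 / e m * \<theta>^4)) sums
      (16/15 * ((1/16)^Suc k * (2 * \<theta>\<^sup>2)) + 16/15 * (17 / e m * \<theta>^4))"
    by (intro sums_add sums_mult2 geo)
  have "(\<Sum>j. (1/16)^j * well_bump ((-1)^j) (e j / 16) x)
      \<le> 16/15 * ((1/16)^Suc k * (2 * \<theta>\<^sup>2)) + 16/15 * (17 / e m * \<theta>^4)"
    using suminf_le[OF termwise summable_bumps sums_summable[OF tot]] sums_unique[OF tot] by simp
  moreover have "16/15 * (17 / e m * \<theta>^4) \<le> 20 / e m * \<theta>^4"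
  proof -
    define Z where "Z = \<theta>^4 / e m"
    have "17 / e m * \<theta>^4 = 17 * Z" "20 / e m * \<theta>^4 = 20 * Z" "Z \<ge> 0"
      using em by (simp_all add: Z_def)
    then show ?thesis by linarith
  qed
  moreover have "(sin (2*pi*x))\<^sup>2 \<le> \<theta>\<^sup>2" using \<theta>(1) sin_power_le(1) by simp
  ultimately show ?thesis unfolding potential_def k_def by (simp add: algebra_simps)
qed

end

section \<open>Scales and the energy gap\<close>

text \<open>Each scale must be so small compared with the preceding one that, at \<open>\<epsilon> = e (Suc j)\<close>, two
  errors are negligible against the energy gap, which is of order \<open>\<epsilon> / 16^Suc j\<close>. One is the
  bending of the soft well caused by the bumps of larger width: relative size \<open>\<epsilon> / e j\<close>, whence the
  fourth condition. The other is the discount \<open>\<epsilon> powr \<alpha>\<close> times the largest value, of order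
  \<open>1 / e j\<close>, of the supersolution on a period, whence the fifth. The fifth can be met precisely
  because \<open>\<alpha> > 1\<close>.\<close>
definition separating_scales :: "real \<Rightarrow> (nat \<Rightarrow> real) \<Rightarrow> bool" where
  "separating_scales \<alpha> e \<longleftrightarrow> (\<forall>j. (0 < e j \<and> e j \<le> (1/16)^j) \<and>
     (e (Suc j) \<le> e j \<and> 4000 * e (Suc j) \<le> (1/16)^Suc j * e j \<and>
      4000 * e (Suc j) powr (\<alpha> - 1) \<le> (1/16)^Suc j * e j))"

lemma rapidly_decreasing_scales:
  fixes \<alpha> :: real
  assumes "\<alpha> > 1"
  obtains e where "separating_scales \<alpha> e"
proof -
  have "\<exists>e. \<forall>n. (0 < e n \<and> e n \<le> (1/16)^n) \<and>
     (e (Suc n) \<le> e n \<and> 4000 * e (Suc n) \<le> (1/16)^Suc n * e n \<and>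
      4000 * e (Suc n) powr (\<alpha> - 1) \<le> (1/16)^Suc n * e n)"
  proof (rule dependent_nat_choice)
    show "\<exists>x::real. 0 < x \<and> x \<le> (1/16)^0" by (rule exI[of _ 1]) simp
  next
    fix x :: real and n assume x: "0 < x \<and> x \<le> (1/16)^n"
    define K where "K = (1/16)^Suc n * x / 4000"
    have K: "K > 0" using x by (simp add: K_def)
    have le1: "(1/16::real)^n \<le> 1" by (intro power_le_one) auto
    then have x1: "x \<le> 1" using x by linarith
    have "(1/16)^Suc n * x \<le> 1 * x" using x le1 by (intro mult_right_mono) auto
    then have Kx: "K \<le> x" using x by (simp add: K_def)
    have "(1/16)^Suc n * x \<le> (1/16)^Suc n * 1" using x1 by (intro mult_left_mono) auto
    then have Kn: "K \<le> (1/16)^Suc n" by (simp add: K_def)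
    define y where "y = min K (K powr (1 / (\<alpha> - 1)))"
    have y: "0 < y" "y \<le> K" using K by (auto simp: y_def)
    have "y powr (\<alpha> - 1) \<le> (K powr (1 / (\<alpha> - 1))) powr (\<alpha> - 1)"
      using y assms by (intro powr_mono2) (auto simp: y_def)
    also have "\<dots> = K" using assms K by (simp add: powr_powr)
    finally have "y powr (\<alpha> - 1) \<le> K" .
    moreover have "y \<le> x" "y \<le> (1/16)^Suc n" using y Kx Kn by linarith+
    ultimately show "\<exists>y. (0 < y \<and> y \<le> (1/16)^Suc n) \<and> (y \<le> x \<and> 4000 * y \<le> (1/16)^Suc n * x \<and>
      4000 * y powr (\<alpha> - 1) \<le> (1/16)^Suc n * x)"
      using y by (intro exI[of _ y]) (simp add: K_def)
  qed
  then show thesis using that unfolding separating_scales_def by blast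
qed

lemma separating_scalesD:
  assumes "separating_scales \<alpha> e"
  shows "\<And>j. 0 < e j" "\<And>j. e j \<le> (1/16)^j" "\<And>j. e (Suc j) \<le> e j"
    "\<And>j. 4000 * e (Suc j) \<le> (1/16)^Suc j * e j"
    "\<And>j. 4000 * e (Suc j) powr (\<alpha> - 1) \<le> (1/16)^Suc j * e j"
  using assms unfolding separating_scales_def by blast+

text \<open>\<open>E\<close> is the upper bound for the discounted solution in terms of the soft well, of stiffness \<open>1 + \<eta>/8\<close>;
  the stiff well admits the subsolution slope \<open>(1 + \<eta>/4) sin\<close>. The leading energies \<open>2*pi*\<epsilon>*(1 + \<eta>/8)\<close> and
  \<open>2*pi*\<epsilon>*(1 + \<eta>/4)\<close> differ by more than \<open>3/4 * \<epsilon> * \<eta>\<close>, and the three errors (the discount term in \<open>E\<close>,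
  the loss \<open>\<eta> * \<epsilon> / 8\<close> of the stiffening bump, and the margin \<open>\<epsilon>^2/2\<close>) together are smaller.
  In the last statement \<open>c\<close> stands for the cosine of the angle from the stiff well.\<close>

lemma energy_gap:
  fixes \<epsilon> \<eta> q \<mu> :: real
  defines "E \<equiv> 2*pi*\<epsilon>*(1 + \<eta>/8) + \<mu> * ((1 + \<eta>/8) + 4 * (20/q))"
  assumes pos: "0 < \<epsilon>" "0 < q" "q \<le> 1" "0 < \<eta>" "\<eta> \<le> 1/16"
    and small: "4000 * \<epsilon> \<le> \<eta> * q" "0 \<le> \<mu>" "4000 * \<mu> \<le> \<epsilon> * (\<eta> * q)"
  shows "(1 + 2/15 * \<eta>) + 6*pi*\<epsilon>*(20/q) \<le> (1 + \<eta>/8)\<^sup>2"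
    and "E \<le> 8 * \<epsilon>"
    and "0 \<le> c \<Longrightarrow> c \<le> 1 \<Longrightarrow> (1 + \<eta>/4)\<^sup>2 * (1 - c\<^sup>2) - 2*pi*(1 + \<eta>/4)*\<epsilon> * c + E + \<epsilon>\<^sup>2/2
      \<le> (1 + \<eta>) * (1 - c\<^sup>2) - \<eta> * \<epsilon> / 8"
proof -
  have pi: "3 < pi" "pi < 3.15" using pi_gt3 pi_approx by simp_all
  have "\<eta> * q \<le> \<eta> * 1" using pos by (intro mult_left_mono) auto
  then have \<epsilon>\<eta>: "4000 * \<epsilon> \<le> \<eta>" using small by simp
  have \<epsilon>q: "\<epsilon>/q \<le> \<eta>/4000"
    unfolding pos_divide_le_eq[OF pos(2)] using small(1) by simp
  have "pi * (\<epsilon>/q) \<le> 3.15 * (\<eta>/4000)" using \<epsilon>q pi pos by (intro mult_mono) simp_all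
  then have "6*pi*\<epsilon>*(20/q) \<le> 0.1 * \<eta>" using pos by (simp add: mult_ac)
  then show "(1 + 2/15 * \<eta>) + 6*pi*\<epsilon>*(20/q) \<le> (1 + \<eta>/8)\<^sup>2"
  proof -
    have "(1 + \<eta>/8)\<^sup>2 = 1 + \<eta>/4 + (\<eta>/8)\<^sup>2" by (simp add: power2_eq_square algebra_simps)
    then show ?thesis using \<open>6*pi*\<epsilon>*(20/q) \<le> 0.1 * \<eta>\<close> pos zero_le_power2[of "\<eta>/8"] by linarith
  qed
  have "\<mu> * ((1 + \<eta>/8) + 4 * (20/q)) \<le> \<mu> * (82/q)"
  proof (rule mult_left_mono)
    have "(1 + \<eta>/8) * q \<le> 2 * 1" using pos by (intro mult_mono) auto
    then have "1 + \<eta>/8 \<le> 2 / q" using pos by (simp add: pos_le_divide_eq)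
    then show "(1 + \<eta>/8) + 4 * (20/q) \<le> 82/q" by simp
  qed fact
  also have "\<mu> * (82/q) = 82 * (\<mu>/q)" by simp
  also have "\<mu>/q \<le> \<epsilon> * \<eta> / 4000" using small(3) pos by (simp add: pos_divide_le_eq mult_ac)
  finally have "\<mu> * ((1 + \<eta>/8) + 4 * (20/q)) \<le> 82 * (\<epsilon> * \<eta> / 4000)" by simp
  also have "\<dots> \<le> 0.1 * (\<epsilon> * \<eta>)" using mult_pos_pos[OF pos(1,4)] by simp
  finally have disc: "\<mu> * ((1 + \<eta>/8) + 4 * (20/q)) \<le> 0.1 * (\<epsilon> * \<eta>)" .
  have \<epsilon>e: "\<epsilon> * \<eta> \<le> \<epsilon> * (1/16)" using pos by (intro mult_left_mono) auto
  have "2*pi*\<epsilon>*(1 + \<eta>/8) \<le> 2*3.15*\<epsilon>*(1 + 1/8)"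
    using pos pi by (intro mult_mono) auto
  then have "E \<le> 2*3.15*\<epsilon>*(1 + 1/8) + 0.1 * (\<epsilon> * \<eta>)"
    unfolding E_def using disc by (rule add_mono)
  also have "\<dots> \<le> 2*3.15*\<epsilon>*(1 + 1/8) + 0.1 * (\<epsilon> * (1/16))"
    by (rule add_left_mono, rule mult_left_mono[OF \<epsilon>e]) simp
  also have "\<dots> \<le> 8 * \<epsilon>" using pos by simp
  finally show "E \<le> 8 * \<epsilon>" .
  assume c: "0 \<le> c" "c \<le> 1"
  define Y where "Y = 1 - c\<^sup>2"
  have "c * c \<le> c * 1" using c by (intro mult_left_mono) auto
  then have cY: "1 - c \<le> Y" by (simp add: Y_def power2_eq_square)
  have Y0: "Y \<ge> 0" using cY c by simp
  have "2*pi*(1 + \<eta>/4)*\<epsilon> * (1 - c) \<le> 2*3.15*(1 + 1/64)*\<epsilon> * Y"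
    using pos pi c cY by (intro mult_mono) auto
  also have "\<dots> \<le> 8 * \<epsilon> * Y" using pos Y0 by (intro mult_right_mono) auto
  also have "\<dots> \<le> (\<eta>/4) * Y" using \<epsilon>\<eta> pos Y0 by (intro mult_right_mono) auto
  finally have 1: "2*pi*(1 + \<eta>/4)*\<epsilon> * (1 - c) \<le> (\<eta>/4) * Y" .
  have "\<eta> * \<eta> \<le> (1/16) * \<eta>" using pos by (intro mult_right_mono) auto
  then have "(1 + \<eta>/4)\<^sup>2 \<le> 1 + 3/4 * \<eta>" using pos by (simp add: power2_eq_square algebra_simps)
  then have 2: "(1 + \<eta>/4)\<^sup>2 * Y \<le> (1 + 3/4 * \<eta>) * Y" using Y0 by (intro mult_right_mono)
  have "\<epsilon> * (4000 * \<epsilon>) \<le> \<epsilon> * \<eta>" using \<epsilon>\<eta> pos by (intro mult_left_mono) auto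
  then have 3: "\<epsilon>\<^sup>2/2 \<le> 0.1 * (\<epsilon> * \<eta>)" using pos by (simp add: power2_eq_square)
  have "3 * (\<epsilon> * \<eta>) \<le> pi * (\<epsilon> * \<eta>)" using pi pos by (intro mult_right_mono) auto
  then have "2*pi*\<epsilon>*(1 + \<eta>/8) \<le> 2*pi*(1 + \<eta>/4)*\<epsilon> - 0.75 * (\<epsilon> * \<eta>)"
    by (simp add: algebra_simps)
  then have "E \<le> (2*pi*(1 + \<eta>/4)*\<epsilon> - 0.75 * (\<epsilon> * \<eta>)) + 0.1 * (\<epsilon> * \<eta>)"
    unfolding E_def using disc by (rule add_mono)
  moreover define A X where "A = 2*pi*(1 + \<eta>/4)*\<epsilon>" and "X = \<epsilon> * \<eta>"
  ultimately have "E \<le> (A - 0.75 * X) + 0.1 * X" by simp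
  moreover have "\<epsilon>\<^sup>2/2 \<le> 0.1 * X" "X > 0" "\<eta> * \<epsilon> = X" using 3 pos by (simp_all add: X_def mult.commute)
  ultimately have 4: "E + \<epsilon>\<^sup>2/2 + \<eta> * \<epsilon> / 8 \<le> A" by simp
  have "A * (1 - c) = A - A * c" by (simp add: right_diff_distrib)
  moreover have "(1 + 3/4 * \<eta>) * Y + \<eta>/4 * Y = (1 + \<eta>) * Y" by (simp add: algebra_simps)
  ultimately show "(1 + \<eta>/4)\<^sup>2 * (1 - c\<^sup>2) - 2*pi*(1 + \<eta>/4)*\<epsilon> * c + E + \<epsilon>\<^sup>2/2
      \<le> (1 + \<eta>) * (1 - c\<^sup>2) - \<eta> * \<epsilon> / 8"
    using 1 2 4 unfolding Y_def[symmetric] A_def[symmetric] by linarith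
qed

section \<open>Alternation of the preferred well\<close>

lemma discounted_solutionD:
  assumes "discounted_solution \<alpha> \<epsilon> V w"
  shows "(w has_real_derivative deriv w x) (at x)"
    and "(deriv w has_real_derivative deriv (deriv w) x) (at x)"
    and "w (x + 1) = w x"
    and "\<epsilon> powr \<alpha> * w x - \<epsilon> * deriv (deriv w) x + (deriv w x)\<^sup>2 = V x"
  using assms unfolding discounted_solution_def C2_torus_def periodic1_def
  by (auto simp: DERIV_deriv_iff_field_differentiable)

text \<open>The well at \<open>p\<close> is the one stiffened by the bump of index \<open>Suc m\<close>. The sign of \<open>w'\<close> at \<open>p\<close> decides on which side
  the descent argument runs; the left side is reduced to the right one by the
  reflection \<open>t \<mapsto> p - t\<close>.\<close>

lemma solution_drops_from_stiff_well:
  fixes e :: "nat \<Rightarrow> real" and w :: "real \<Rightarrow> real" and \<alpha> p r :: real and m :: nat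
  defines "\<epsilon> \<equiv> e (Suc m)"
  assumes scales: "separating_scales \<alpha> e"
    and sol: "discounted_solution \<alpha> \<epsilon> (potential e) w"
    and p: "\<And>t. cos (2*pi*(p + t)) = (-1)^Suc m * cos (2*pi*t)"
    and r: "0 < r" "r \<le> 1/8"
    and small: "\<epsilon> < 1/32" "8*\<epsilon> < (sin (pi * r))\<^sup>2"
      "128*pi\<^sup>2*\<epsilon> < r * (cos (3*pi * r/2) - cos (2*pi * r))\<^sup>2"
  shows "w (p + r) - w (p + 1/2 - r) \<ge> 1/32 \<or> w (p - r) - w (p - 1/2 + r) \<ge> 1/32"
proof -
  note e = separating_scalesD[OF scales]
  define \<eta> q \<mu> :: real where "\<eta> = (1/16)^Suc m" and "q = e m" and "\<mu> = \<epsilon> powr \<alpha>"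
  define E where "E = 2*pi*\<epsilon>*(1 + \<eta>/8) + \<mu> * ((1 + \<eta>/8) + 4 * (20/q))"
  have "(1/16::real)^m \<le> 1" by (intro power_le_one) auto
  then have pos: "0 < \<epsilon>" "0 < q" "q \<le> 1" "0 < \<eta>" "\<eta> \<le> 1/16"
    using e(1)[of "Suc m"] e(1)[of m] e(2)[of m] by (auto simp: \<epsilon>_def q_def \<eta>_def)
  have "\<mu> = \<epsilon> * \<epsilon> powr (\<alpha> - 1)"
    using pos powr_add[of \<epsilon> 1 "\<alpha> - 1"] by (simp add: \<mu>_def)
  then have "4000 * \<mu> = \<epsilon> * (4000 * \<epsilon> powr (\<alpha> - 1))" by simp
  also have "\<dots> \<le> \<epsilon> * (\<eta> * q)"
    using e(5)[of m] pos unfolding \<eta>_def q_def \<epsilon>_def by (intro mult_left_mono) auto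
  finally have \<mu>_small: "4000 * \<mu> \<le> \<epsilon> * (\<eta> * q)" .
  have \<mu>0: "\<mu> > 0" using pos by (simp add: \<mu>_def)
  have \<epsilon>_small: "4000 * \<epsilon> \<le> \<eta> * q" using e(4)[of m] by (simp only: \<epsilon>_def \<eta>_def q_def)
  note gap = energy_gap[OF pos \<epsilon>_small less_imp_le[OF \<mu>0] \<mu>_small, folded E_def]
  note D = discounted_solutionD[OF sol, folded \<mu>_def]
  have sin_p: "(sin (2*pi*(p + t)))\<^sup>2 = (sin (2*pi*t))\<^sup>2" for t
    using p[of t] sin_squared_eq[of "2*pi*t"] sin_squared_eq[of "2*pi*(p+t)"]
    by (simp add: power_mult_distrib flip: power_mult)
  have shifted: "((\<lambda>t. f (a + t)) has_real_derivative f' (a + t)) (at t)"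
    "((\<lambda>t. f (a - t)) has_real_derivative - f' (a - t)) (at t)"
    if "\<And>x. (f has_real_derivative f' x) (at x)" for f f' a t
  proof -
    have "((\<lambda>t. a + t) has_real_derivative 1) (at t)" "((\<lambda>t. a - t) has_real_derivative -1) (at t)"
      by (auto intro!: derivative_eq_intros)
    from this[THEN DERIV_chain2[OF that]] show "((\<lambda>t. f (a + t)) has_real_derivative f' (a + t)) (at t)"
      "((\<lambda>t. f (a - t)) has_real_derivative - f' (a - t)) (at t)" by simp_all
  qed
  have upper: "\<mu> * w x \<le> E" for x
  proof -
    define s where "s = p + 1/2"
    have soft: "potential e (s + t) \<le> (1 + 2/15 * \<eta>) * (2*pi*t)\<^sup>2 + 20 / q * (2*pi*t)^4" for t
      unfolding \<eta>_def q_def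
    proof (rule potential_soft_well[of e, OF e(1) e(3)])
      have st: "s + t = p + (1/2 + t)" by (simp add: s_def)
      have per: "sin (2*pi*(1/2 + t)) = - sin (2*pi*t)" "cos (2*pi*(1/2 + t)) = - cos (2*pi*t)"
        by (simp_all add: distrib_left)
      show "(sin (2*pi*(s + t)))\<^sup>2 = (sin (2*pi*t))\<^sup>2" unfolding st sin_p per by simp
      have "(-1)^Suc m * ((-1)^Suc m * z) = z" for z :: real
        by (simp flip: mult.assoc power_mult_distrib)
      then show "(-1)^Suc m * cos (2*pi*(s + t)) = - cos (2*pi*t)" unfolding st p per by simp
    qed (use e(2)[of 0] in simp)
    have "\<mu> * w (s + (x - s)) \<le> 2*pi*\<epsilon>*(1 + \<eta>/8) + \<mu> * ((1 + \<eta>/8) + 4 * (20/q))"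
    proof (rule discounted_solution_upper_bound[where w = "\<lambda>t. w (s + t)" and x = "x - s" and v = "\<lambda>t. deriv w (s + t)"
          and v' = "\<lambda>t. deriv (deriv w) (s + t)" and F = "\<lambda>t. potential e (s + t)"
          and a = "1 + 2/15 * \<eta>"])
      show "w (s + (t + 1)) = w (s + t)" for t using D(3)[of "s + t"] by (simp add: add.assoc)
    qed (use D shifted soft pos \<mu>0 gap(1) in auto)
    then show ?thesis by (simp add: E_def)
  qed
  have lower: "potential e (p + t) \<ge> (1 + \<eta>/4)\<^sup>2 * (sin (2*pi*t))\<^sup>2
      - 2*pi*(1 + \<eta>/4)*\<epsilon> * cos (2*pi*t) + E + \<epsilon>\<^sup>2/2" if t: "\<bar>t\<bar> \<le> 1/4" for t
  proof -
    have c: "cos (2*pi*t) \<ge> 0"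
    proof (rule cos_ge_zero)
      have "2*pi*\<bar>t\<bar> \<le> 2*pi*(1/4)" using t by (intro mult_left_mono) auto
      then have "\<bar>2*pi*t\<bar> \<le> pi/2" by (simp add: abs_mult)
      then show "- (pi/2) \<le> 2*pi*t" "2*pi*t \<le> pi/2" by linarith+
    qed
    have "(-1)^Suc m * cos (2*pi*(p + t)) = cos (2*pi*t)"
      unfolding p by (simp flip: mult.assoc power_mult_distrib)
    then have "potential e (p + t) \<ge> (1 + \<eta>) * (sin (2*pi*t))\<^sup>2 - \<eta> * \<epsilon> / 8"
      using potential_stiff_well[of e "Suc m" "p + t", OF e(1)] c sin_p[of t] unfolding \<eta>_def \<epsilon>_def by simp
    then show ?thesis using gap(3)[OF c] by (simp add: sin_squared_eq)
  qed
  have \<kappa>: "1 \<le> 1 + \<eta>/4" "1 + \<eta>/4 \<le> 2" using pos by auto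
  have V_ge: "potential e (p + t) \<ge> (sin (2*pi*t))\<^sup>2" for t
    using potential_ge_sin[of e "p + t", OF e(1)] sin_p[of t] by simp
  show ?thesis
  proof (cases "deriv w p \<le> 0")
    case True
    have "w (p + r) - w (p + (1/2 - r)) \<ge> 1/32"
      by (rule descent_across_stiff_well[where w = "\<lambda>t. w (p + t)" and v = "\<lambda>t. deriv w (p + t)" and \<epsilon> = \<epsilon> and r = r and \<mu> = \<mu>
          and v' = "\<lambda>t. deriv (deriv w) (p + t)" and F = "\<lambda>t. potential e (p + t)" and \<kappa> = "1 + \<eta>/4"])
         (use D shifted V_ge lower upper \<kappa> r small pos gap(2) True in auto)
    then show ?thesis by (simp add: add_diff_eq)
  next
    case False
    have "w (p - r) - w (p - (1/2 - r)) \<ge> 1/32"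
    proof (rule descent_across_stiff_well[where w = "\<lambda>t. w (p - t)" and v = "\<lambda>t. - deriv w (p - t)" and \<epsilon> = \<epsilon> and r = r and \<mu> = \<mu>
          and v' = "\<lambda>t. deriv (deriv w) (p - t)" and F = "\<lambda>t. potential e (p - t)" and \<kappa> = "1 + \<eta>/4"])
      show "((\<lambda>t. - deriv w (p - t)) has_real_derivative deriv (deriv w) (p - t)) (at t)" for t
        using DERIV_minus[OF shifted(2)[of "deriv w" "deriv (deriv w)" p t]] D(2) by simp
      show "(sin (2*pi*t))\<^sup>2 \<le> potential e (p - t)" for t
        using V_ge[of "-t"] by simp
      show "(1 + \<eta>/4)\<^sup>2 * (sin (2*pi*t))\<^sup>2 - 2*pi*(1 + \<eta>/4)*\<epsilon> * cos (2*pi*t) + E + \<epsilon>\<^sup>2/2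
          \<le> potential e (p - t)" if "\<bar>t\<bar> \<le> 1/4" for t
        using lower[of "-t"] that by simp
    qed (use D shifted upper \<kappa> r small pos gap(2) False in auto)
    then show ?thesis by (simp add: algebra_simps)
  qed
qed

text \<open>The scales \<open>e k\<close> with \<open>k\<close> of the parity of \<open>b\<close> tend to \<open>0\<close> and all favour the well opposite to \<open>p\<close>. Differences of
  values of \<open>w \<epsilon> + C \<epsilon>\<close> are differences of values of \<open>w \<epsilon>\<close>, so they inherit the drop for small
  \<open>\<epsilon>\<close>, at points \<open>r\<close> away from the wells; continuity of the limit then allows \<open>r\<close> to tend
  to \<open>0\<close>. The maximum \<open>h\<close> of the two one-sided drops absorbs the dependence of the side on \<open>r\<close>.\<close>

lemma limit_drops_from_well:
  fixes e :: "nat \<Rightarrow> real" and w :: "real \<Rightarrow> real \<Rightarrow> real" and \<alpha> p :: real and b :: nat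
  assumes scales: "separating_scales \<alpha> e"
    and sol: "\<forall>\<epsilon>>0. discounted_solution \<alpha> \<epsilon> (potential e) (w \<epsilon>)"
    and lim: "uniform_limit UNIV (\<lambda>\<epsilon> x. w \<epsilon> x + C \<epsilon>) z0 (at_right 0)"
    and cont: "continuous_on UNIV z0" and per: "\<And>x. z0 (x + 1) = z0 x"
    and p: "\<And>t. cos (2*pi*(p + t)) = (-1)^b * cos (2*pi*t)"
  shows "z0 p - z0 (p + 1/2) \<ge> 1/64"
proof -
  note e = separating_scalesD[OF scales]
  have "\<forall>\<^sub>F \<epsilon> in at_right 0. \<forall>x\<in>UNIV. dist (w \<epsilon> x + C \<epsilon>) (z0 x) < 1/256"
    using uniform_limitD[OF lim, of "1/256"] by simp
  then obtain \<epsilon>0 where \<epsilon>0: "\<epsilon>0 > 0"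
    and near: "\<And>\<epsilon> x. 0 < \<epsilon> \<Longrightarrow> \<epsilon> < \<epsilon>0 \<Longrightarrow> \<bar>w \<epsilon> x + C \<epsilon> - z0 x\<bar> < 1/256"
    unfolding eventually_at_right_field by (auto simp: dist_real_def)
  define h where "h r = max (z0 (p + r) - z0 (p + 1/2 - r)) (z0 (p - r) - z0 (p - 1/2 + r))" for r
  have h_ge: "h r \<ge> 1/64" if r: "0 < r" "r \<le> 1/8" for r
  proof -
    define \<delta> where "\<delta> = min (min \<epsilon>0 (1/32)) (min ((sin (pi * r))\<^sup>2 / 8)
      (r * (cos (3*pi * r/2) - cos (2*pi * r))\<^sup>2 / (128*pi\<^sup>2)))"
    have "pi * r < pi * 1" using r by (intro mult_strict_left_mono) auto
    then have "sin (pi * r) > 0" using r by (intro sin_gt_zero) auto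
    moreover have "cos (2*pi * r) < cos (3*pi * r/2)"
    proof (rule cos_monotone_0_pi)
      have "2*pi * r \<le> 2*pi*(1/8)" using r by (intro mult_left_mono) auto
      then show "2*pi * r \<le> pi" using pi_gt_zero by simp
    qed (use r in auto)
    ultimately have "\<delta> > 0" using \<epsilon>0 r by (simp add: \<delta>_def)
    then obtain N where N: "(1/16::real)^N < \<delta>" using real_arch_pow_inv[of \<delta> "1/16"] by auto
    define m where "m = 2 * N + b + 1"
    have "e (Suc m) \<le> (1/16)^Suc m" by (rule e)
    also have "\<dots> \<le> (1/16)^N" by (intro power_decreasing) (auto simp: m_def)
    finally have "e (Suc m) < \<delta>" using N by simp
    then have small: "e (Suc m) < \<epsilon>0" "e (Suc m) < 1/32" "e (Suc m) < (sin (pi * r))\<^sup>2 / 8"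
      "e (Suc m) < r * (cos (3*pi * r/2) - cos (2*pi * r))\<^sup>2 / (128*pi\<^sup>2)"
      unfolding \<delta>_def by auto
    have parity: "(-1::real)^Suc m = (-1)^b" by (simp add: m_def power_add)
    have "w (e (Suc m)) (p + r) - w (e (Suc m)) (p + 1/2 - r) \<ge> 1/32
      \<or> w (e (Suc m)) (p - r) - w (e (Suc m)) (p - 1/2 + r) \<ge> 1/32"
    proof (rule solution_drops_from_stiff_well[OF scales _ _ r small(2)])
      show "discounted_solution \<alpha> (e (Suc m)) (potential e) (w (e (Suc m)))" using sol e(1) by blast
      show "cos (2*pi*(p + t)) = (-1)^Suc m * cos (2*pi*t)" for t unfolding parity by (rule p)
      show "8 * e (Suc m) < (sin (pi * r))\<^sup>2" using small(3) by simp
      show "128*pi\<^sup>2 * e (Suc m) < r * (cos (3*pi * r/2) - cos (2*pi * r))\<^sup>2"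
        using small(4) by (simp add: pos_less_divide_eq mult.commute)
    qed
    then show ?thesis
      using near[OF e(1) small(1), of "p + r"] near[OF e(1) small(1), of "p + 1/2 - r"]
        near[OF e(1) small(1), of "p - r"] near[OF e(1) small(1), of "p - 1/2 + r"]
      unfolding h_def max_def abs_less_iff by argo
  qed
  have z: "continuous_on UNIV (\<lambda>r. z0 (g r))" if "continuous_on UNIV g" for g :: "real \<Rightarrow> real"
    using continuous_on_compose2[OF cont that] by simp
  have "continuous_on UNIV h"
    unfolding h_def by (intro continuous_intros z)
  then have "(h \<longlongrightarrow> h 0) (at_right 0)"
    by (meson UNIV_I continuous_on_eq_continuous_at isCont_def open_UNIV tendsto_within_subset subset_UNIV)
  moreover have "\<forall>\<^sub>F r in at_right 0. 1/64 \<le> h r"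
    unfolding eventually_at_right_field using h_ge by (intro exI[of _ "1/8"]) auto
  ultimately have "1/64 \<le> h 0" by (intro tendsto_lowerbound) auto
  moreover have "z0 (p - 1/2) = z0 (p + 1/2)" using per[of "p - 1/2"] by (simp add: algebra_simps)
  ultimately show ?thesis by (simp add: h_def)
qed

theorem theorem1p4:
  fixes \<alpha> :: real
  assumes "\<alpha> > 1"
  shows "\<exists>V \<in> C2_torus.
           (\<forall>x. V x \<ge> 0) \<and>
           card {x \<in> {0..<1}. V x = 0} = 2 \<and>
           (\<forall>x. V x = 0 \<longrightarrow> deriv (deriv V) x > 0) \<and>
           (\<forall>(w :: real \<Rightarrow> real \<Rightarrow> real) (c :: real \<Rightarrow> real).
              (\<forall>\<epsilon>>0. discounted_solution \<alpha> \<epsilon> V (w \<epsilon>)) \<longrightarrow>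
              (\<forall>\<epsilon>>0. ergodic_constant \<epsilon> V (c \<epsilon>)) \<longrightarrow>
              \<not> converges_in_C_torus (\<lambda>\<epsilon> x. w \<epsilon> x + c \<epsilon> / \<epsilon> powr \<alpha>))"
proof -
  obtain e where scales: "separating_scales \<alpha> e"
    using rapidly_decreasing_scales[OF assms] .
  note e = separating_scalesD[OF scales]
  show ?thesis
  proof (intro bexI[of _ "potential e"] conjI allI impI)
    show "potential e \<in> C2_torus" using potential_C2 e(1) by blast
    show "0 \<le> potential e x" for x
      using potential_ge_sin[of e x, OF e(1)] zero_le_power2[of "sin (2*pi*x)"] by linarith
    show "card {x \<in> {0..<1}. potential e x = 0} = 2" using card_potential_zeros e(1) by blast
    show "deriv (deriv (potential e)) x > 0" if "potential e x = 0" for x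
      using potential_nondegenerate[of e x] e(1) that by blast
    fix w :: "real \<Rightarrow> real \<Rightarrow> real" and c :: "real \<Rightarrow> real"
    assume sol: "\<forall>\<epsilon>>0. discounted_solution \<alpha> \<epsilon> (potential e) (w \<epsilon>)"
    show "\<not> converges_in_C_torus (\<lambda>\<epsilon> x. w \<epsilon> x + c \<epsilon> / \<epsilon> powr \<alpha>)"
    proof
      assume "converges_in_C_torus (\<lambda>\<epsilon> x. w \<epsilon> x + c \<epsilon> / \<epsilon> powr \<alpha>)"
      then obtain z0 where z0: "z0 \<in> C_torus"
        and lim: "uniform_limit UNIV (\<lambda>\<epsilon> x. w \<epsilon> x + c \<epsilon> / \<epsilon> powr \<alpha>) z0 (at_right 0)"
        unfolding converges_in_C_torus_def by blast
      have cont: "continuous_on UNIV z0" and per: "\<And>x. z0 (x + 1) = z0 x"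
        using z0 by (auto simp: C_torus_def periodic1_def)
      have "z0 p - z0 (p + 1/2) > 0"
        if p: "\<And>t. cos (2*pi*(p + t)) = (-1)^b * cos (2*pi*t)" for p and b :: nat
        using limit_drops_from_well[OF scales sol lim cont per p] by simp
      from this[of 0 0] this[of "1/2" 1] have "z0 0 - z0 (1/2) > 0" "z0 (1/2) - z0 1 > 0"
        by (simp_all add: distrib_left)
      then show False using per[of 0] by simp
    qed
  qed
qed

end
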